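(* Let $1<p<\infty$, $n\ge1$, and let $f\in C([0,\infty))$ and $g\in C^{0,1}([0,\infty))$ be strictly increasing with $f(0)=g(0)=0$. Set $F(s)=\int_0^s f(t)\,dt$ and $$\Gamma(s)=\int_0^{2s} g(t)\,dt+\frac{p-1}{p}\,c\,s^p,\qquad c=\Big(\frac{p}{p-1}\Big)^p n .$$ (i) If $$\int_1^\infty \frac{ds}{\Gamma^{-1}(F(s))}<\infty,$$ then every nonnegative (smooth) subsolution $u$ of $\Delta_p u=f(u)-g(|\nabla u|)$ in $\mathbb{R}^n$, i.e. $\Delta_p u\ge f(u)-g(|\nabla u|)$ in $\mathbb{R}^n$, vanishes identically. (ii) If $$\int_1^\infty \frac{ds}{F(s)^{1/p}}=\infty\qquad\text{or}\qquad \int_1^\infty\frac{ds}{g^{-1}(f(s))}=\infty,$$ then the equation $\Delta_p u=f(u)-g(|\nabla u|)$ in $\mathbb{R}^n$ admits at least one positive solution.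
   Context: $\Delta_p u:=\operatorname{div}(|\nabla u|^{p-2}\nabla u)$ is the $p$-Laplacian. $\Gamma^{-1}$ and $g^{-1}$ denote inverse functions of the strictly increasing functions $\Gamma$ and $g$. *)

theory Defs
  imports "HOL-Analysis.Analysis"
begin

definition grad :: "('a::euclidean_space \<Rightarrow> real) \<Rightarrow> 'a \<Rightarrow> 'a" where
  "grad u x = (\<Sum>b\<in>Basis. frechet_derivative u (at x) b *\<^sub>R b)"

text \<open>The p-Laplacian flux  |grad u|^(p-2) grad u  (equal to 0 where grad u = 0).\<close>
definition plap_flux :: "real \<Rightarrow> ('a::euclidean_space \<Rightarrow> real) \<Rightarrow> 'a \<Rightarrow> 'a" where
  "plap_flux p u x = (norm (grad u x) powr (p - 2)) *\<^sub>R grad u x"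

definition divergence :: "('a::euclidean_space \<Rightarrow> 'a) \<Rightarrow> 'a \<Rightarrow> real" where
  "divergence V x = (\<Sum>b\<in>Basis. frechet_derivative V (at x) b \<bullet> b)"

text \<open>Classical regularity: u is C^1 and the flux |grad u|^(p-2) grad u is C^1,
  so that Delta_p u = div(flux) is a continuous function defined pointwise.\<close>
definition plap_regular :: "real \<Rightarrow> ('a::euclidean_space \<Rightarrow> real) \<Rightarrow> bool" where
  "plap_regular p u \<longleftrightarrow>
     (\<forall>x. u differentiable (at x)) \<and> continuous_on UNIV (grad u) \<and>
     (\<forall>x. plap_flux p u differentiable (at x)) \<and>
     (\<forall>b\<in>Basis. continuous_on UNIV (\<lambda>x. frechet_derivative (plap_flux p u) (at x) b))"

definition p_laplacian :: "real \<Rightarrow> ('a::euclidean_space \<Rightarrow> real) \<Rightarrow> 'a \<Rightarrow> real" where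
  "p_laplacian p u x = divergence (plap_flux p u) x"

definition plap_subsolution ::
  "real \<Rightarrow> (real \<Rightarrow> real) \<Rightarrow> (real \<Rightarrow> real) \<Rightarrow> ('a::euclidean_space \<Rightarrow> real) \<Rightarrow> bool" where
  "plap_subsolution p f g u \<longleftrightarrow> plap_regular p u \<and>
     (\<forall>x. p_laplacian p u x \<ge> f (u x) - g (norm (grad u x)))"

definition plap_solution ::
  "real \<Rightarrow> (real \<Rightarrow> real) \<Rightarrow> (real \<Rightarrow> real) \<Rightarrow> ('a::euclidean_space \<Rightarrow> real) \<Rightarrow> bool" where
  "plap_solution p f g u \<longleftrightarrow> plap_regular p u \<and>
     (\<forall>x. p_laplacian p u x = f (u x) - g (norm (grad u x)))"

definition primF :: "(real \<Rightarrow> real) \<Rightarrow> real \<Rightarrow> real" where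
  "primF f s = integral {0..s} f"

definition Gam :: "real \<Rightarrow> nat \<Rightarrow> (real \<Rightarrow> real) \<Rightarrow> real \<Rightarrow> real" where
  "Gam p n g s = integral {0 .. 2 * s} g
      + (p - 1) / p * ((p / (p - 1)) powr p * real n) * s powr p"

definition inv0 :: "(real \<Rightarrow> real) \<Rightarrow> real \<Rightarrow> real" where
  "inv0 h y = the_inv_into {0..} h y"

text \<open>Integrand 1/g^{-1}(f(s)), with the convention 1/g^{-1}(y) = 0 (i.e. g^{-1}(y) = inf)
  when y is not in the range of g on [0,inf).\<close>
definition recip_ginv_f :: "(real \<Rightarrow> real) \<Rightarrow> (real \<Rightarrow> real) \<Rightarrow> real \<Rightarrow> real" where
  "recip_ginv_f f g s = (if \<exists>t\<ge>0. g t = f s then 1 / inv0 g (f s) else 0)"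

end

theory Submission
  imports Defs "HOL-Complex_Analysis.Great_Picard"
begin

text \<open>
  Let \<open>q = p / (p - 1)\<close>, so that \<open>\<Delta>\<^sub>p |x|\<^bsup>q\<^esup>\<close> is the constant \<open>q\<^bsup>p-1\<^esup> n\<close>.

  For (i), choose \<open>k > 0\<close> nondecreasing and \<open>\<Psi>(s) = \<integral>\<^sub>a\<^sup>s q / k\<close>. If \<open>\<Psi>(u)\<close> is bounded, then
  \<open>\<Psi>(u(x)) - |x - y|\<^bsup>q\<^esup>\<close> attains its maximum, and at a maximum point \<open>x \<noteq> y\<close> with \<open>r = |x - y|\<close> the
  second-order condition reads
  \<open>\<Delta>\<^sub>p u \<le> n k\<^bsup>p-1\<^esup> + (p - 1) k\<^bsup>p-1\<^esup> k' r\<^bsup>q\<^esup>\<close> and \<open>|\<nabla>u| = k r\<^bsup>q-1\<^esup>\<close>. If this contradicts the subsolution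
  property, then \<open>x = y\<close> for every centre \<open>y\<close> with \<open>u(y) > a\<close>, so \<open>\<nabla>u = 0\<close> on \<open>{u > a}\<close>, which is
  impossible where \<open>f(u) > 0\<close>; hence \<open>u \<le> a\<close>. Taking \<open>k = \<Gamma>\<^sup>-\<^sup>1 \<circ> F\<close> and \<open>a\<close> large shows that \<open>u\<close> is
  bounded, and then small constants \<open>k\<close> give \<open>u \<le> a\<close> for every \<open>a > 0\<close>.

  For (ii), solve the radial equation for \<open>u(x) = \<phi>(|x|)\<close>, \<open>\<phi>(0) = 1\<close>, in the unknown \<open>h = \<phi>'\<^bsup>p-1\<^esup>\<close>.
  Either hypothesis yields \<open>\<phi>' \<le> K(\<phi>)\<close> with \<open>\<integral>\<^sup>\<infinity> 1 / K = \<infinity>\<close>: by the energy inequality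
  \<open>\<phi>'\<^bsup>p\<^esup> \<le> q F(\<phi>)\<close>, or because \<open>g(\<phi>') \<le> f(\<phi>)\<close> persists along the flow. So \<open>\<phi> \<le> M\<close>
  for the solution of \<open>M' = K(M)\<close>, \<open>M(0) = 1\<close>, and one may solve the equation with \<open>f(\<phi>)\<close> replaced
  by \<open>f(min \<phi> M)\<close>, whose solutions cannot blow up.
\<close>

section \<open>Calculus on half-lines\<close>

lemma deriv_pos_imp_less_atLeast:
  fixes h :: "real \<Rightarrow> real"
  assumes c: "continuous_on {a..} h" and d: "\<And>x. a < x \<Longrightarrow> (h has_real_derivative h' x) (at x)"
    and pos: "\<And>x. a < x \<Longrightarrow> 0 < h' x" and st: "a \<le> s" "s < t"
  shows "h s < h t"
proof (rule DERIV_pos_imp_increasing_open[OF st(2)])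
  show "\<exists>y. (h has_real_derivative y) (at x) \<and> 0 < y" if "s < x" "x < t" for x
    using d[of x] pos[of x] that st by (intro exI[of _ "h' x"]) auto
  show "continuous_on {s..t} h" using c by (rule continuous_on_subset) (use st in auto)
qed

lemma has_real_derivative_integral_within_atLeast:
  fixes k :: "real \<Rightarrow> real"
  assumes c: "continuous_on {a..} k" and s: "a \<le> s"
  shows "((\<lambda>s. integral {a..s} k) has_real_derivative k s) (at s within {a..})"
proof -
  have "((\<lambda>s. integral {a..s} k) has_real_derivative k s) (at s within {a..s + 1})"
    by (rule integral_has_real_derivative) (use s in \<open>auto intro: continuous_on_subset[OF c]\<close>)
  moreover have "at s within {a..s + 1} = at s within {a..}"
    by (rule at_within_nhd[of _ "{..<s + 1}"]) (use s in auto)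
  ultimately show ?thesis by simp
qed

lemma has_real_derivative_integral_atLeast:
  fixes k :: "real \<Rightarrow> real"
  assumes c: "continuous_on {a..} k" and s: "a < s"
  shows "((\<lambda>s. integral {a..s} k) has_real_derivative k s) (at s)"
  using has_real_derivative_integral_within_atLeast[OF c, of s] s
    at_within_open_subset[of s "{a<..}" "{a..}"] by (simp add: subset_eq)

lemma continuous_on_integral_atLeast:
  fixes k :: "real \<Rightarrow> real"
  assumes c: "continuous_on {a..} k"
  shows "continuous_on {a..} (\<lambda>s. integral {a..s} k)"
  unfolding continuous_on_eq_continuous_within
  using has_real_derivative_integral_within_atLeast[OF c] by (auto intro: DERIV_continuous)

section \<open>Inverse functions and improper integrals on the half-line\<close>

lemma inv0_strict_mono:
  assumes "strict_mono_on {0..} h" "0 \<le> s"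
  shows "inv0 h (h s) = s"
  unfolding inv0_def
  by (rule the_inv_into_f_f) (use assms strict_mono_on_imp_inj_on in auto)

text \<open>By strict monotonicity, an image point lying between \<open>h (x - e)\<close> and
  \<open>h (x + e)\<close> has its preimage between \<open>x - e\<close> and \<open>x + e\<close>. A
  jump of \<open>h\<close> only removes points from the domain of the inverse.\<close>

lemma continuous_on_inv0:
  assumes h: "strict_mono_on {0..} h"
  shows "continuous_on (h ` {0..}) (inv0 h)"
  unfolding continuous_on_iff
proof (intro ballI allI impI)
  fix y and e :: real assume "y \<in> h ` {0..}" and e: "0 < e"
  then obtain x where x: "0 \<le> x" "y = h x" by auto
  have lt: "h s < h t \<longleftrightarrow> s < t" if "0 \<le> s" "0 \<le> t" for s t
    using that h by (auto simp: strict_mono_on_less)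
  \<comment> \<open>When \<open>x < e\<close>, every preimage is nonnegative and so already exceeds
    \<open>x - e\<close>; the left gap is then unconstrained and 1 is an arbitrary positive
    value.\<close>
  define d where "d = min (h (x + e) - y) (if e \<le> x then y - h (x - e) else 1)"
  have d: "0 < d" using x e by (auto simp: d_def lt)
  have "dist (inv0 h z) (inv0 h y) < e" if z: "z \<in> h ` {0..}" "dist z y < d" for z
  proof -
    obtain t where t: "0 \<le> t" "z = h t" using z by auto
    have "h t < h (x + e)" using z t by (auto simp: d_def dist_real_def)
    then have 1: "t < x + e" using x e t by (simp add: lt)
    have 2: "x - e < t"
    proof (cases "e \<le> x")
      case True
      then have "h (x - e) < h t" using z t by (auto simp: d_def dist_real_def)
      then show ?thesis using True x e t by (simp add: lt)
    qed (use t in auto)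
    show ?thesis using 1 2 by (simp add: x t inv0_strict_mono[OF h] dist_real_def abs_less_iff)
  qed
  with d show "\<exists>d>0. \<forall>x'\<in>h ` {0..}. dist x' y < d \<longrightarrow> dist (inv0 h x') (inv0 h y) < e" by blast
qed

lemma image_atLeast0_unbounded:
  fixes h :: "real \<Rightarrow> real"
  assumes "continuous_on {0..} h" "strict_mono_on {0..} h" "h 0 = 0" "\<And>y. \<exists>s\<ge>0. y \<le> h s"
  shows "h ` {0..} = {0..}"
proof (intro equalityI subsetI)
  fix y assume "y \<in> h ` {0..}"
  then obtain s where "0 \<le> s" "y = h s" by auto
  then show "y \<in> {0..}"
    using strict_mono_onD[OF assms(2), of 0 s] assms(3) by (cases "s = 0") auto
next
  fix y :: real assume y: "y \<in> {0..}"
  obtain s where s: "0 \<le> s" "y \<le> h s" using assms(4) by auto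
  have "\<exists>x\<ge>0. x \<le> s \<and> h x = y"
    by (rule IVT') (use s y assms(3) continuous_on_subset[OF assms(1)] in auto)
  then show "y \<in> h ` {0..}" by auto
qed

text \<open>Monotone convergence over the intervals \<open>{a..a + real N}\<close>. It links the
  Lebesgue integrals of the hypotheses, which may be infinite, to the primitives that the later
  arguments differentiate.\<close>

lemma nn_integral_atLeast_eq_SUP:
  fixes k :: "real \<Rightarrow> real"
  assumes c: "continuous_on {a..} k" and pos: "\<And>s. a \<le> s \<Longrightarrow> 0 \<le> k s"
  shows "(\<integral>\<^sup>+ s\<in>{a..}. ennreal (k s) \<partial>lborel) = (SUP N. ennreal (integral {a..a + real N} k))"
proof -
  have meas: "(\<lambda>s. ennreal (k s) * indicator {a..b} s) \<in> borel_measurable lborel" for b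
  proof -
    have "(\<lambda>s. indicator {a..b} s *\<^sub>R k s) \<in> borel_measurable borel"
      by (rule borel_measurable_continuous_on_indicator)
        (auto intro: continuous_on_subset[OF c])
    then have "(\<lambda>s. ennreal (indicator {a..b} s *\<^sub>R k s)) \<in> borel_measurable lborel"
      by simp
    then show ?thesis
      by (rule measurable_cong[THEN iffD1, rotated]) (auto simp: indicator_def)
  qed
  have sup: "ennreal (k s) * indicator {a..} s = (SUP N. ennreal (k s) * indicator {a..a + real N} s)" for s
  proof (rule antisym)
    obtain N where "s - a \<le> real N" using real_arch_simple by blast
    then have "ennreal (k s) * indicator {a..} s \<le> ennreal (k s) * indicator {a..a + real N} s"
      by (auto simp: indicator_def)
    then show "ennreal (k s) * indicator {a..} s \<le> (SUP N. ennreal (k s) * indicator {a..a + real N} s)"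
      by (rule SUP_upper2[OF UNIV_I])
    show "(SUP N. ennreal (k s) * indicator {a..a + real N} s) \<le> ennreal (k s) * indicator {a..} s"
      by (rule SUP_least) (auto simp: indicator_def)
  qed
  have "(\<integral>\<^sup>+ s\<in>{a..}. ennreal (k s) \<partial>lborel) = (\<integral>\<^sup>+ s. (SUP N. ennreal (k s) * indicator {a..a + real N} s) \<partial>lborel)"
    by (simp only: sup)
  also have "\<dots> = (SUP N. \<integral>\<^sup>+ s. ennreal (k s) * indicator {a..a + real N} s \<partial>lborel)"
    by (rule nn_integral_monotone_convergence_SUP)
      (simp_all only: meas, auto simp: incseq_def le_fun_def indicator_def)
  also have "\<dots> = (SUP N. ennreal (integral {a..a + real N} k))"
  proof -
    have "k integrable_on {a..b}" for b
      by (rule integrable_continuous_interval) (auto intro: continuous_on_subset[OF c])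
    then have "(\<integral>\<^sup>+ s. ennreal (k s) * indicator {a..a + real N} s \<partial>lborel) = ennreal (integral {a..a + real N} k)" for N
      by (intro nn_integral_has_integral_lebesgue') (auto intro: pos integrable_integral)
    then show ?thesis by simp
  qed
  finally show ?thesis .
qed

lemma nn_integral_atLeast_finite_imp_bounded:
  fixes k :: "real \<Rightarrow> real"
  assumes c: "continuous_on {a..} k" and pos: "\<And>s. a \<le> s \<Longrightarrow> 0 \<le> k s"
    and fin: "(\<integral>\<^sup>+ s\<in>{a..}. ennreal (k s) \<partial>lborel) < \<infinity>"
  obtains B where "\<And>s. a \<le> s \<Longrightarrow> integral {a..s} k \<le> B"
proof -
  obtain B where B: "(\<integral>\<^sup>+ s\<in>{a..}. ennreal (k s) \<partial>lborel) = ennreal B" "0 \<le> B"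
    using fin by (metis ennreal_cases less_irrefl infinity_ennreal_def)
  have int: "k integrable_on {a..b}" for b
    by (rule integrable_continuous_interval) (auto intro: continuous_on_subset[OF c])
  have "integral {a..s} k \<le> B" if "a \<le> s" for s
  proof -
    obtain N where N: "s - a \<le> real N" using real_arch_simple by blast
    have "ennreal (integral {a..a + real N} k) \<le> (SUP N. ennreal (integral {a..a + real N} k))"
      by (rule SUP_upper) auto
    also have "\<dots> = ennreal B"
      using nn_integral_atLeast_eq_SUP[OF c pos] B(1) by simp
    finally have "integral {a..a + real N} k \<le> B" using B(2) by (simp add: ennreal_le_iff)
    moreover have "integral {a..s} k \<le> integral {a..a + real N} k"
      by (rule integral_subset_le) (use N int pos in auto)
    ultimately show ?thesis by simp
  qed
  then show ?thesis by (rule that)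
qed

lemma nn_integral_atLeast_infinite_imp_unbounded:
  fixes k :: "real \<Rightarrow> real"
  assumes c: "continuous_on {a..} k" and pos: "\<And>s. a \<le> s \<Longrightarrow> 0 \<le> k s"
    and inf: "(\<integral>\<^sup>+ s\<in>{a..}. ennreal (k s) \<partial>lborel) = \<infinity>"
  shows "\<exists>s\<ge>a. B \<le> integral {a..s} k"
proof (rule ccontr)
  assume "\<not> ?thesis"
  then have "integral {a..a + real N} k \<le> B" for N
    by (smt (verit) of_nat_0_le_iff)
  then have "(SUP N. ennreal (integral {a..a + real N} k)) \<le> ennreal B"
    by (intro SUP_least ennreal_leI) auto
  then show False using nn_integral_atLeast_eq_SUP[OF c pos] inf by (simp add: top_unique)
qed

section \<open>Touching by powers of the distance\<close>

text \<open>Rewriting \<open>norm w powr m\<close> as \<open>(w \<bullet> w) powr (m / 2)\<close>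
  leaves a power of a positive smooth quantity. With \<open>m = p - 2\<close> this linearises the
  flux; with \<open>m = q - 2\<close> it linearises the inverse of the flux map and the gradient of
  |x - y|^q.\<close>

lemma has_derivative_norm_powr_scaleR:
  fixes w :: "'a::euclidean_space"
  assumes "w \<noteq> 0"
  shows "((\<lambda>w. norm w powr m *\<^sub>R w) has_derivative
    (\<lambda>b. norm w powr m *\<^sub>R (b + (m * (w \<bullet> b) / (norm w)\<^sup>2) *\<^sub>R w))) (at w)"
proof -
  have pos: "0 < w \<bullet> w" using assms by simp
  have eq: "norm v powr m = (v \<bullet> v) powr (m / 2)" for v :: 'a
    by (simp add: norm_eq_sqrt_inner powr_half_sqrt[symmetric] powr_powr)
  have "((\<lambda>v. (v \<bullet> v) powr (m / 2)) has_derivative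
      (\<lambda>b. (w \<bullet> w) powr (m / 2) * (0 * ln (w \<bullet> w) + (w \<bullet> b + b \<bullet> w) * (m / 2) / (w \<bullet> w)))) (at w)"
    by (rule has_derivative_powr) (use pos in \<open>auto intro!: derivative_eq_intros\<close>)
  from has_derivative_scaleR[OF this has_derivative_ident]
  show ?thesis
    unfolding eq
    by (rule has_derivative_eq_rhs)
      (simp add: fun_eq_iff inner_commute power2_norm_eq_inner algebra_simps)
qed

lemma has_derivative_norm_powr:
  fixes w :: "'a::euclidean_space"
  assumes "w \<noteq> 0"
  shows "((\<lambda>w. norm w powr m) has_derivative
    (\<lambda>b. (m * norm w powr (m - 2)) * (w \<bullet> b))) (at w)"
proof -
  have pos: "0 < w \<bullet> w" using assms by simp
  have eq: "norm v powr m = (v \<bullet> v) powr (m / 2)" for v :: 'a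
    by (simp add: norm_eq_sqrt_inner powr_half_sqrt[symmetric] powr_powr)
  have "((\<lambda>v. (v \<bullet> v) powr (m / 2)) has_derivative
      (\<lambda>b. (w \<bullet> w) powr (m / 2) * (0 * ln (w \<bullet> w) + (w \<bullet> b + b \<bullet> w) * (m / 2) / (w \<bullet> w)))) (at w)"
    by (rule has_derivative_powr) (use pos in \<open>auto intro!: derivative_eq_intros\<close>)
  moreover have "norm w powr (m - 2) = norm w powr m / (w \<bullet> w)"
    using assms by (simp add: powr_diff power2_norm_eq_inner)
  ultimately show ?thesis
    unfolding eq[symmetric]
    by (elim has_derivative_eq_rhs)
      (simp add: fun_eq_iff inner_commute algebra_simps)
qed

text \<open>The gradient \<open>N\<close> is assumed differentiable at the single point
  \<open>x0\<close>, so the test runs along a line. If \<open>D b \<bullet> b\<close> were positive,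
  \<open>N \<bullet> b\<close> would be positive on a short segment leaving \<open>x0\<close> in
  direction \<open>b\<close>, and the mean value theorem would produce a larger value of
  \<open>J\<close> there.\<close>

lemma second_order_necessary_max:
  fixes J :: "'a::euclidean_space \<Rightarrow> real"
  assumes S: "open S" "x0 \<in> S"
    and dJ: "\<And>x. x \<in> S \<Longrightarrow> (J has_derivative (\<lambda>b. N x \<bullet> b)) (at x)"
    and dN: "(N has_derivative D) (at x0)"
    and mx: "\<And>x. x \<in> S \<Longrightarrow> J x \<le> J x0"
  shows "D b \<bullet> b \<le> 0"
proof -
  have "(\<lambda>b. N x0 \<bullet> b) = (\<lambda>b. 0)"
    by (rule differential_zero_maxmin[OF S(2,1) dJ[OF S(2)]]) (use mx in auto)
  then have "N x0 \<bullet> N x0 = 0" by meson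
  then have N0: "N x0 = 0" by simp
  show "D b \<bullet> b \<le> 0"
  proof (rule ccontr)
    assume "\<not> D b \<bullet> b \<le> 0"
    then have pos: "0 < D b \<bullet> b" by simp
    have lin: "D (t *\<^sub>R b) = t *\<^sub>R D b" for t
      using has_derivative_linear[OF dN] by (simp add: linear_cmul)
    have line: "((\<lambda>t. x0 + t *\<^sub>R b) has_derivative (\<lambda>h. h *\<^sub>R b)) (at t)" for t
      by (auto intro!: derivative_eq_intros)
    have dN': "(N has_derivative D) (at (x0 + 0 *\<^sub>R b))" using dN by simp
    have "((\<lambda>t. N (x0 + t *\<^sub>R b)) has_derivative (\<lambda>h. D (h *\<^sub>R b))) (at 0)"
      by (rule has_derivative_compose[OF line dN'])
    then have "((\<lambda>t. N (x0 + t *\<^sub>R b) \<bullet> b) has_derivative (\<lambda>h. D (h *\<^sub>R b) \<bullet> b)) (at 0)"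
      by (rule has_derivative_inner_left)
    then have "((\<lambda>t. N (x0 + t *\<^sub>R b) \<bullet> b) has_real_derivative (D b \<bullet> b)) (at 0)"
      unfolding has_field_derivative_def
      by (rule has_derivative_eq_rhs) (auto simp: lin)
    from DERIV_pos_inc_right[OF this pos] obtain d1 where d1: "d1 > 0"
      "\<And>h. 0 < h \<Longrightarrow> h < d1 \<Longrightarrow> 0 < N (x0 + h *\<^sub>R b) \<bullet> b"
      using N0 by auto
    have "((\<lambda>t. x0 + t *\<^sub>R b) \<longlongrightarrow> x0 + 0 *\<^sub>R b) (at_right (0::real))"
      by (intro tendsto_intros)
    then have "\<forall>\<^sub>F t in at_right (0::real). x0 + t *\<^sub>R b \<in> S"
      by (rule topological_tendstoD) (use S in auto)
    then obtain d2 where d2: "d2 > 0" "\<And>t. 0 < t \<Longrightarrow> t < d2 \<Longrightarrow> x0 + t *\<^sub>R b \<in> S"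
      unfolding eventually_at_right_field by (auto)
    define h where "h = min d1 d2 / 2"
    have h: "0 < h" "h < d1" "h < d2" using d1 d2 by (auto simp: h_def)
    have inS: "x0 + t *\<^sub>R b \<in> S" if "0 \<le> t" "t \<le> h" for t
      using d2(2)[of t] h that S by (cases "t = 0") auto
    have dj: "((\<lambda>t. J (x0 + t *\<^sub>R b)) has_real_derivative (N (x0 + t *\<^sub>R b) \<bullet> b)) (at t)"
      if "0 \<le> t" "t \<le> h" for t
      using has_derivative_compose[OF line dJ[OF inS[OF that]]]
      unfolding has_field_derivative_def by (rule has_derivative_eq_rhs) auto
    obtain t where t: "0 < t" "t < h"
      "J (x0 + h *\<^sub>R b) - J (x0 + 0 *\<^sub>R b) = (h - 0) * (N (x0 + t *\<^sub>R b) \<bullet> b)"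
      using MVT2[OF h(1), of "\<lambda>t. J (x0 + t *\<^sub>R b)" "\<lambda>t. N (x0 + t *\<^sub>R b) \<bullet> b"] dj by auto
    then have "J (x0 + h *\<^sub>R b) > J x0"
      using mult_pos_pos[OF h(1) d1(2)[of t]] h by simp
    then show False using mx[OF inS[of h]] h by auto
  qed
qed

lemma linear_inner_eq_sum_Basis:
  fixes D :: "'a::euclidean_space \<Rightarrow> 'a"
  assumes lin: "linear D"
  shows "(\<Sum>b\<in>Basis. (e \<bullet> b) * (D b \<bullet> e)) = D e \<bullet> e"
proof -
  have "D e = D (\<Sum>b\<in>Basis. (e \<bullet> b) *\<^sub>R b)" by (simp add: euclidean_representation)
  also have "\<dots> = (\<Sum>b\<in>Basis. (e \<bullet> b) *\<^sub>R D b)"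
    using lin by (simp add: linear_sum linear_cmul)
  finally show ?thesis by (simp add: inner_sum_left)
qed

text \<open>With \<open>Q = I - e \<otimes> e\<close> the trace of \<open>Q D Q\<close> is \<open>tr D - (D e) \<bullet> e\<close>; this handles \<open>p < 2\<close>.\<close>
lemma trace_plus_radial_nonpos:
  fixes D :: "'a::euclidean_space \<Rightarrow> 'a"
  assumes lin: "linear D" and neg: "\<And>b. D b \<bullet> b \<le> 0" and e: "norm e = 1" and p: "1 < p"
  shows "(\<Sum>b\<in>Basis. D b \<bullet> b) + (p - 2) * (D e \<bullet> e) \<le> 0"
proof -
  let ?Q = "\<lambda>b. b - (b \<bullet> e) *\<^sub>R e"
  have e1: "e \<bullet> e = 1" using e by (simp add: norm_eq_1)
  have D: "D (?Q b) = D b - (b \<bullet> e) *\<^sub>R D e" for b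
    using lin by (simp add: linear_diff linear_cmul)
  have s1: "(\<Sum>b\<in>Basis. (b \<bullet> e) * (D b \<bullet> e)) = D e \<bullet> e"
    using linear_inner_eq_sum_Basis[OF lin, of e] by (simp add: inner_commute[of e])
  have s2: "(\<Sum>b\<in>Basis. (b \<bullet> e) * (D e \<bullet> b)) = D e \<bullet> e"
    unfolding euclidean_inner[of "D e" e] by (intro sum.cong refl) (simp add: inner_commute[of e])
  have s3: "(\<Sum>b\<in>Basis. (b \<bullet> e) * (b \<bullet> e)) = 1"
    using e1 unfolding euclidean_inner[of e e] by (simp add: inner_commute)
  have "(\<Sum>b\<in>Basis. D (?Q b) \<bullet> ?Q b) =
      (\<Sum>b\<in>Basis. D b \<bullet> b - (b \<bullet> e) * (D b \<bullet> e) - (b \<bullet> e) * (D e \<bullet> b) + (b \<bullet> e) * (b \<bullet> e) * (D e \<bullet> e))"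
    by (intro sum.cong refl) (simp add: D inner_diff_left inner_diff_right algebra_simps)
  also have "\<dots> = (\<Sum>b\<in>Basis. D b \<bullet> b) - D e \<bullet> e"
    by (simp add: sum.distrib sum_subtractf s1 s2 sum_distrib_right[symmetric] s3)
  \<comment> \<open>The projection trades the coefficient \<open>p - 2\<close>, which may be
    negative, for \<open>p - 1 > 0\<close>.\<close>
  finally have "(\<Sum>b\<in>Basis. D b \<bullet> b) + (p - 2) * (D e \<bullet> e)
      = (\<Sum>b\<in>Basis. D (?Q b) \<bullet> ?Q b) + (p - 1) * (D e \<bullet> e)"
    by (simp add: algebra_simps)
  also have "\<dots> \<le> 0 + 0"
    by (intro add_mono sum_nonpos neg mult_nonneg_nonpos) (use p in auto)
  finally show ?thesis by simp
qed

section \<open>Gradient, divergence and flux; the touching inequality\<close>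

lemma grad_has_derivative:
  assumes "u differentiable (at x)"
  shows "(u has_derivative (\<lambda>b. grad u x \<bullet> b)) (at x)"
proof -
  have d: "(u has_derivative frechet_derivative u (at x)) (at x)"
    using assms by (simp add: frechet_derivative_works)
  have "frechet_derivative u (at x) b = grad u x \<bullet> b" for b
  proof -
    have "linear (frechet_derivative u (at x))" using d by (rule has_derivative_linear)
    then have "frechet_derivative u (at x) (\<Sum>i\<in>Basis. (b \<bullet> i) *\<^sub>R i)
        = (\<Sum>i\<in>Basis. (b \<bullet> i) * frechet_derivative u (at x) i)"
      by (simp add: linear_sum linear_cmul)
    then have "frechet_derivative u (at x) b = (\<Sum>i\<in>Basis. (b \<bullet> i) * frechet_derivative u (at x) i)"
      by (simp only: euclidean_representation)
    also have "\<dots> = grad u x \<bullet> b"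
      unfolding grad_def inner_sum_left by (intro sum.cong refl) (simp add: inner_commute[of b])
    finally show ?thesis .
  qed
  then show ?thesis using d by presburger
qed

lemma grad_eqI:
  assumes "(u has_derivative (\<lambda>b. v \<bullet> b)) (at x)"
  shows "grad u x = v"
  using frechet_derivative_at[OF assms, symmetric]
  by (simp add: grad_def euclidean_representation)

lemma divergence_eqI:
  assumes "(V has_derivative D) (at x)"
  shows "divergence V x = (\<Sum>b\<in>Basis. D b \<bullet> b)"
  using frechet_derivative_at[OF assms, symmetric] by (simp add: divergence_def)

text \<open>This makes the gradient differentiable wherever it does not vanish.\<close>
lemma grad_eq_of_flux:
  assumes p: "1 < p" and q: "q = p / (p - 1)"
  shows "grad u x = norm (plap_flux p u x) powr (q - 2) *\<^sub>R plap_flux p u x"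
proof (cases "grad u x = 0")
  case True
  then show ?thesis by (simp add: plap_flux_def)
next
  case False
  let ?m = "norm (grad u x)"
  have m: "?m > 0" using False by simp
  have "norm (plap_flux p u x) = ?m powr (p - 1)"
    using m by (simp add: plap_flux_def powr_mult_base powr_diff power2_eq_square)
  moreover have "(p - 1) * (q - 2) + (p - 2) = 0"
    using p by (simp add: q field_simps)
  ultimately show ?thesis
    using m by (simp add: plap_flux_def powr_powr powr_add[symmetric])
qed

text \<open>At the interior maximum the Hessian of \<open>\<Psi>\<close>(u) - |x - y|^q is
  nonpositive. Contracting it with I + (p - 2) e e^T, where e is the direction of the gradient,
  produces the second-order part of \<open>p_laplacian p u x0\<close>. Differentiating the weight 1
  / k(u) is the source of the \<open>k'\<close> term.\<close>

lemma p_laplacian_touching: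
  fixes u :: "'a::euclidean_space \<Rightarrow> real"
  assumes p: "1 < p" and q: "q = p / (p - 1)" and reg: "plap_regular p u"
    and S: "open S" "x0 \<in> S" and x0: "x0 \<noteq> y"
    and k_pos: "\<And>x. x \<in> S \<Longrightarrow> 0 < k (u x)"
    and dPsi: "\<And>x. x \<in> S \<Longrightarrow> (\<Psi> has_real_derivative (q / k (u x))) (at (u x))"
    and dk: "(k has_real_derivative k') (at (u x0))"
    and mx: "\<And>x. x \<in> S \<Longrightarrow>
      \<Psi> (u x) - norm (x - y) powr q \<le> \<Psi> (u x0) - norm (x0 - y) powr q"
  defines "r \<equiv> norm (x0 - y)"
  shows "norm (grad u x0) = k (u x0) * r powr (q - 1)"
    and "p_laplacian p u x0 \<le> DIM('a) * k (u x0) powr (p - 1)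
            + (p - 1) * k (u x0) powr (p - 1) * k' * r powr q"
proof -
  have q1: "q > 1" and pq: "p * q = p + q" using p by (auto simp: q field_simps)
  have r: "r > 0" using x0 by (simp add: r_def)
  let ?s = "u x0"
  have k0: "k ?s > 0" using k_pos S by auto
  define e where "e = (1 / r) *\<^sub>R (x0 - y)"
  have e: "norm e = 1" "x0 - y = r *\<^sub>R e" using r by (auto simp: e_def r_def)
  have e1: "e \<bullet> e = 1" using e by (simp add: norm_eq_1)
  define N where "N x = (q / k (u x)) *\<^sub>R grad u x - q *\<^sub>R (norm (x - y) powr (q - 2) *\<^sub>R (x - y))" for x
  let ?J = "\<lambda>x. \<Psi> (u x) - norm (x - y) powr q"
  have du: "(u has_derivative (\<lambda>b. grad u x \<bullet> b)) (at x)" for x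
    using reg by (auto simp: plap_regular_def intro: grad_has_derivative)
  \<comment> \<open>The centre is removed because the factor
    \<open>norm (x - y) powr (q - 2)\<close> in \<open>N\<close> is singular there for
    \<open>q < 2\<close>.\<close>
  have dJ: "(?J has_derivative (\<lambda>b. N x \<bullet> b)) (at x)" if "x \<in> S - {y}" for x
  proof -
    have "((\<lambda>x. \<Psi> (u x)) has_derivative (\<lambda>b. (q / k (u x)) * (grad u x \<bullet> b))) (at x)"
      using has_derivative_compose[OF du dPsi[unfolded has_field_derivative_def]] that by auto
    moreover have "((\<lambda>x. norm (x - y) powr q) has_derivative
        (\<lambda>b. (q * norm (x - y) powr (q - 2)) * ((x - y) \<bullet> b))) (at x)"
      by (rule has_derivative_compose[of "\<lambda>x. x - y" "\<lambda>b. b", OF _ has_derivative_norm_powr])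
        (use that in \<open>auto intro!: derivative_eq_intros\<close>)
    ultimately have "(?J has_derivative (\<lambda>b. (q / k (u x)) * (grad u x \<bullet> b)
        - (q * norm (x - y) powr (q - 2)) * ((x - y) \<bullet> b))) (at x)"
      by (rule has_derivative_diff)
    then show ?thesis
      by (rule has_derivative_eq_rhs) (auto simp: N_def inner_diff_left algebra_simps)
  qed
  define V where "V = plap_flux p u"
  have dV: "(V has_derivative frechet_derivative V (at x0)) (at x0)"
    using reg by (auto simp: plap_regular_def V_def frechet_derivative_works[symmetric])
  have S': "open (S - {y})" "x0 \<in> S - {y}" using S x0 by auto
  have gradV: "grad u = (\<lambda>x. norm (V x) powr (q - 2) *\<^sub>R V x)"
    unfolding V_def by (rule ext, rule grad_eq_of_flux[OF p q])
  have "(\<lambda>b. N x0 \<bullet> b) = (\<lambda>b. 0)"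
    by (rule differential_zero_maxmin[OF S'(2,1) dJ[OF S'(2)]]) (use mx in auto)
  then have "N x0 \<bullet> N x0 = 0" by meson
  then have N0: "N x0 = 0" by simp
  have rq: "r powr (q - 2) * r = r powr (q - 1)"
    using r by (simp add: powr_diff power2_eq_square)
  have "(q / k ?s) *\<^sub>R grad u x0 = q *\<^sub>R (r powr (q - 2) *\<^sub>R (x0 - y))"
    using N0 by (simp add: N_def r_def)
  then have "(k ?s / q) *\<^sub>R (q / k ?s) *\<^sub>R grad u x0
      = (k ?s / q) *\<^sub>R q *\<^sub>R (r powr (q - 2) *\<^sub>R (x0 - y))"
    by simp
  then have g0: "grad u x0 = (k ?s * r powr (q - 1)) *\<^sub>R e"
    using k0 q1 by (simp add: e(2) rq)
  define G where "G = k ?s * r powr (q - 1)"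
  have G: "G > 0" using k0 r by (simp add: G_def)
  have g0': "grad u x0 = G *\<^sub>R e" using g0 by (simp add: G_def)
  show ng: "norm (grad u x0) = k (u x0) * r powr (q - 1)"
    using k0 r by (simp add: g0 e)
  have gn: "grad u x0 \<noteq> 0" using g0' G e by auto
  have Vn: "V x0 \<noteq> 0"
    using gn gradV by auto
  \<comment> \<open>The Hessian of \<open>u\<close> exists here because the gradient is a smooth
    function of the flux \<open>V\<close> away from \<open>V = 0\<close>, and \<open>V\<close> is
    differentiable.\<close>
  obtain H where H: "(grad u has_derivative H) (at x0)"
  proof -
    have "((\<lambda>x. norm (V x) powr (q - 2) *\<^sub>R V x) has_derivative
        (\<lambda>b. norm (V x0) powr (q - 2) *\<^sub>R (frechet_derivative V (at x0) b +
          ((q - 2) * (V x0 \<bullet> frechet_derivative V (at x0) b) / (norm (V x0))\<^sup>2) *\<^sub>R V x0))) (at x0)"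
      by (rule has_derivative_compose[OF dV has_derivative_norm_powr_scaleR[OF Vn]])
    then have "(grad u has_derivative
        (\<lambda>b. norm (V x0) powr (q - 2) *\<^sub>R (frechet_derivative V (at x0) b +
          ((q - 2) * (V x0 \<bullet> frechet_derivative V (at x0) b) / (norm (V x0))\<^sup>2) *\<^sub>R V x0))) (at x0)"
      by (subst gradV)
    then show ?thesis by (rule that)
  qed
  have linH: "linear H" using H by (rule has_derivative_linear)
  have "(V has_derivative (\<lambda>b. norm (grad u x0) powr (p - 2) *\<^sub>R
     (H b + ((p - 2) * (grad u x0 \<bullet> H b) / (norm (grad u x0))\<^sup>2) *\<^sub>R grad u x0))) (at x0)"
    unfolding V_def plap_flux_def
    by (rule has_derivative_compose[OF H has_derivative_norm_powr_scaleR[OF gn]])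
  then have "p_laplacian p u x0 = (\<Sum>b\<in>Basis. (norm (grad u x0) powr (p - 2) *\<^sub>R
     (H b + ((p - 2) * (grad u x0 \<bullet> H b) / (norm (grad u x0))\<^sup>2) *\<^sub>R grad u x0)) \<bullet> b)"
    unfolding p_laplacian_def V_def by (rule divergence_eqI)
  also have "\<dots> = (\<Sum>b\<in>Basis. G powr (p - 2) * (H b \<bullet> b + (p - 2) * ((e \<bullet> H b) * (e \<bullet> b))))"
    using G e(1) by (intro sum.cong refl)
      (simp add: g0' inner_add_left power2_eq_square)
  also have "\<dots> = G powr (p - 2) * ((\<Sum>b\<in>Basis. H b \<bullet> b) + (p - 2) * (\<Sum>b\<in>Basis. (e \<bullet> H b) * (e \<bullet> b)))"
    by (simp only: sum_distrib_left[symmetric] sum.distrib)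
  also have "(\<Sum>b\<in>Basis. (e \<bullet> H b) * (e \<bullet> b)) = H e \<bullet> e"
    using linear_inner_eq_sum_Basis[OF linH, of e] by (simp add: inner_commute[of e] mult.commute)
  finally have lap: "p_laplacian p u x0 = G powr (p - 2) * ((\<Sum>b\<in>Basis. H b \<bullet> b) + (p - 2) * (H e \<bullet> e))" .

  define D where "D b = (q / k ?s) *\<^sub>R H b - (q * k' / (k ?s)\<^sup>2 * (grad u x0 \<bullet> b)) *\<^sub>R grad u x0
     - q *\<^sub>R (r powr (q - 2) *\<^sub>R (b + ((q - 2) * ((x0 - y) \<bullet> b) / r\<^sup>2) *\<^sub>R (x0 - y)))" for b
  have dN: "(N has_derivative D) (at x0)"
  proof -
    have "((\<lambda>s. q / k s) has_real_derivative (- q * k' / (k ?s)\<^sup>2)) (at ?s)"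
      by (rule derivative_eq_intros refl dk)+
        (use k0 in \<open>auto simp: power2_eq_square\<close>)
    from has_derivative_compose[OF du this[unfolded has_field_derivative_def]]
    have 1: "((\<lambda>x. q / k (u x)) has_derivative (\<lambda>b. - q * k' / (k ?s)\<^sup>2 * (grad u x0 \<bullet> b))) (at x0)" .
    have 2: "((\<lambda>x. norm (x - y) powr (q - 2) *\<^sub>R (x - y)) has_derivative
       (\<lambda>b. norm (x0 - y) powr (q - 2) *\<^sub>R (b + ((q - 2) * ((x0 - y) \<bullet> b) / (norm (x0 - y))\<^sup>2) *\<^sub>R (x0 - y)))) (at x0)"
      by (rule has_derivative_compose[of "\<lambda>x. x - y" "\<lambda>b. b", OF _ has_derivative_norm_powr_scaleR])
        (use x0 in \<open>auto intro!: derivative_eq_intros\<close>)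
    show ?thesis
      unfolding N_def
      using has_derivative_diff[OF has_derivative_scaleR[OF 1 H]
          has_derivative_scaleR_right[OF 2, of q]]
      by (rule has_derivative_eq_rhs) (auto simp: D_def r_def fun_eq_iff algebra_simps)
  qed
  have negD: "D b \<bullet> b \<le> 0" for b
    by (rule second_order_necessary_max[OF S' dJ dN]) (use mx in auto)
  have linD: "linear D" using dN by (rule has_derivative_linear)
  \<comment> \<open>The combination of trace and radial entry is the one in \<open>lap\<close>, with
    \<open>D\<close> in place of \<open>H\<close>.\<close>
  have "(\<Sum>b\<in>Basis. D b \<bullet> b) + (p - 2) * (D e \<bullet> e) \<le> 0"
    by (rule trace_plus_radial_nonpos[OF linD negD e(1) p])
  moreover have Db: "D b \<bullet> b = q * (H b \<bullet> b / k ?s - k' * (r powr (q - 1))\<^sup>2 * (e \<bullet> b)\<^sup>2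
      - r powr (q - 2) * (b \<bullet> b + (q - 2) * (e \<bullet> b)\<^sup>2))" for b
    unfolding D_def g0 e(2) using k0 r
    by (simp add: inner_diff_left inner_add_left power2_eq_square field_simps)
  have sB: "(\<Sum>b\<in>Basis. (e \<bullet> b)\<^sup>2) = 1"
    using e1 unfolding euclidean_inner[of e e] by (simp add: power2_eq_square)
  have "(\<Sum>b\<in>Basis. D b \<bullet> b) = q * ((\<Sum>b\<in>Basis. H b \<bullet> b) / k ?s - k' * (r powr (q - 1))\<^sup>2
      - r powr (q - 2) * (DIM('a) + (q - 2)))"
  proof -
    have "(\<Sum>b\<in>Basis. D b \<bullet> b) = (\<Sum>b\<in>Basis. q * (H b \<bullet> b / k ?s - k' * (r powr (q - 1))\<^sup>2 * (e \<bullet> b)\<^sup>2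
      - r powr (q - 2) * (1 + (q - 2) * (e \<bullet> b)\<^sup>2)))"
      by (intro sum.cong refl) (simp add: Db)
    also have "\<dots> = q * ((\<Sum>b\<in>Basis. H b \<bullet> b) / k ?s - k' * (r powr (q - 1))\<^sup>2 * (\<Sum>b\<in>Basis. (e \<bullet> b)\<^sup>2)
      - r powr (q - 2) * (DIM('a) + (q - 2) * (\<Sum>b\<in>Basis. (e \<bullet> b)\<^sup>2)))"
      by (simp add: sum_distrib_left[symmetric] sum_subtractf sum.distrib sum_divide_distrib[symmetric])
    finally show ?thesis by (simp add: sB)
  qed
  moreover have "D e \<bullet> e = q * (H e \<bullet> e / k ?s - k' * (r powr (q - 1))\<^sup>2
      - r powr (q - 2) * (1 + (q - 2)))"
    by (simp add: Db e1)
  \<comment> \<open>The distance terms have total coefficient DIM('a) + (q - 2) + (p - 2)(q - 1) =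
    DIM('a) + pq - p - q, and conjugacy leaves only the dimension. This reflects that the
    p-Laplacian of |x|^q is constant.\<close>
  ultimately have "q * (((\<Sum>b\<in>Basis. H b \<bullet> b) + (p - 2) * (H e \<bullet> e)) / k ?s
      - (p - 1) * k' * (r powr (q - 1))\<^sup>2 - r powr (q - 2) * (DIM('a) + (p * q - p - q))) \<le> 0"
    by (simp add: algebra_simps add_divide_distrib diff_divide_distrib)
  then have "((\<Sum>b\<in>Basis. H b \<bullet> b) + (p - 2) * (H e \<bullet> e)) / k ?s
      \<le> (p - 1) * k' * (r powr (q - 1))\<^sup>2 + r powr (q - 2) * DIM('a)"
    using q1 pq by (simp add: mult_le_0_iff)
  then have T: "(\<Sum>b\<in>Basis. H b \<bullet> b) + (p - 2) * (H e \<bullet> e)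
      \<le> k ?s * ((p - 1) * k' * (r powr (q - 1))\<^sup>2 + r powr (q - 2) * DIM('a))"
    using k0 by (simp add: field_simps)
  have "p_laplacian p u x0 \<le> G powr (p - 2) * (k ?s * ((p - 1) * k' * (r powr (q - 1))\<^sup>2 + r powr (q - 2) * DIM('a)))"
    unfolding lap by (intro mult_left_mono T) auto
  \<comment> \<open>Powers of \<open>k\<close> and \<open>r\<close> are collected; conjugacy then
    turns the exponent of \<open>r\<close> into \<open>q\<close> in the \<open>k'\<close> term and
    into 0 in the dimension term.\<close>
  also have "\<dots> = k ?s powr (p - 1) * r powr ((q - 1) * (p - 2)) *
      ((p - 1) * k' * r powr ((q - 1) * 2) + r powr (q - 2) * DIM('a))"
  proof -
    have "G powr (p - 2) = k ?s powr (p - 2) * r powr ((q - 1) * (p - 2))"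
      using k0 r by (simp add: G_def powr_mult powr_powr)
    moreover have "k ?s powr (p - 2) * k ?s = k ?s powr (p - 1)"
      using k0 by (simp add: powr_diff power2_eq_square)
    moreover have "(r powr (q - 1))\<^sup>2 = r powr ((q - 1) * 2)"
      by (simp add: power2_eq_square powr_add[symmetric] mult.commute)
    ultimately show ?thesis by (simp add: mult_ac)
  qed
  also have "\<dots> = k ?s powr (p - 1) * ((p - 1) * k' * r powr ((q - 1) * (p - 2) + (q - 1) * 2)
      + r powr ((q - 1) * (p - 2) + (q - 2)) * DIM('a))"
    by (simp only: powr_add) (simp only: ring_distribs mult_ac)
  also have "(q - 1) * (p - 2) + (q - 1) * 2 = q" using pq by (simp add: algebra_simps)
  also have "(q - 1) * (p - 2) + (q - 2) = 0" using pq by (simp add: algebra_simps)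
  finally show "p_laplacian p u x0 \<le> DIM('a) * k (u x0) powr (p - 1)
            + (p - 1) * k (u x0) powr (p - 1) * k' * r powr q"
    using r by (simp add: algebra_simps)
qed

section \<open>Comparison on the whole space\<close>

lemma has_derivative_norm_powr_0:
  fixes y :: "'a::euclidean_space"
  assumes "1 < q"
  shows "((\<lambda>x. norm (x - y) powr q) has_derivative (\<lambda>b. 0)) (at y)"
proof -
  have "((\<lambda>h. norm h powr (q - 1)) \<longlongrightarrow> norm (0::'a) powr (q - 1)) (at (0::'a))"
    by (rule tendsto_powr2[OF tendsto_norm[OF tendsto_ident_at] tendsto_const]) (use assms in auto)
  moreover have "\<forall>\<^sub>F h::'a in at 0. norm h powr (q - 1)
      = norm (norm (y + h - y) powr q - norm (y - y) powr q - 0) / norm h"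
    by (auto simp: eventually_at_filter powr_diff)
  ultimately have "((\<lambda>h::'a. norm (norm (y + h - y) powr q - norm (y - y) powr q - 0) / norm h)
      \<longlongrightarrow> norm (0::'a) powr (q - 1)) (at 0)"
    by (rule Lim_transform_eventually)
  then show ?thesis
    unfolding has_derivative_at using assms by simp
qed

text \<open>Boundedness of \<open>\<Psi>\<close> along \<open>u\<close> replaces decay at infinity:
  it confines the maximum of the penalised function to a ball. Since the maximum value is positive,
  \<open>ineq\<close> is only asked for radii with \<open>r powr q \<le> \<Psi> (u x)\<close>. The
  lemma serves both a weight adapted to \<open>f\<close> and \<open>g\<close> and constant
  weights.\<close>

lemma subsolution_le_of_bounded_transform:
  fixes u :: "'a::euclidean_space \<Rightarrow> real"
  assumes p: "1 < p" and q: "q = p / (p - 1)" and sub: "plap_subsolution p f g u"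
    and f_pos: "\<And>s. a < s \<Longrightarrow> 0 < f s" and g0: "g 0 = 0"
    and k_pos: "\<And>s. a < s \<Longrightarrow> 0 < k s"
    and dk: "\<And>s. a < s \<Longrightarrow> (k has_real_derivative k' s) (at s)"
    and Psi_cont: "continuous_on {a..} \<Psi>" and Psi_a: "\<Psi> a = 0"
    and dPsi: "\<And>s. a < s \<Longrightarrow> (\<Psi> has_real_derivative (q / k s)) (at s)"
    and bound: "\<And>x. a < u x \<Longrightarrow> \<Psi> (u x) \<le> B"
    and ineq: "\<And>x r. \<lbrakk>a < u x; 0 < r; r powr q \<le> \<Psi> (u x)\<rbrakk> \<Longrightarrow>
       DIM('a) * k (u x) powr (p - 1) + (p - 1) * k (u x) powr (p - 1) * k' (u x) * r powr q
         + g (k (u x) * r powr (q - 1)) < f (u x)"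
  shows "u x \<le> a"
proof (rule ccontr)
  assume "\<not> u x \<le> a"
  have reg: "plap_regular p u" using sub by (simp add: plap_subsolution_def)
  have q1: "q > 1" using p by (auto simp: q field_simps)
  have du: "(u has_derivative (\<lambda>b. grad u x \<bullet> b)) (at x)" for x
    using reg by (auto simp: plap_regular_def intro: grad_has_derivative)
  have ucont: "continuous_on UNIV u"
    using du by (meson continuous_at_imp_continuous_on has_derivative_continuous)
  define U where "U = {y. a < u y}"
  have U: "open U" unfolding U_def using ucont by (intro open_Collect_less) auto
  have Psi_pos: "0 < \<Psi> s" if "a < s" for s
    using deriv_pos_imp_less_atLeast[OF Psi_cont dPsi, of a s] that k_pos q1 by (simp add: Psi_a)
  have grad0: "grad u y = 0" if y: "y \<in> U" for y
  proof -
    \<comment> \<open>Since \<open>\<Psi> a = 0\<close>, truncating \<open>u\<close> at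
      \<open>a\<close> extends \<open>\<Psi> (u x)\<close> continuously by zero to the whole ball,
      so the maximum can be taken before it is known to lie in \<open>U\<close>.\<close>
    define J where "J x = \<Psi> (max a (u x)) - norm (x - y) powr q" for x
    \<comment> \<open>\<open>\<rho> powr q\<close> exceeds \<open>B\<close>, so the penalty beats
      \<open>\<Psi>\<close> on the sphere and the maximum is interior.\<close>
    define \<rho> where "\<rho> = (\<bar>B\<bar> + 1) powr (1 / q)"
    have rho: "\<rho> > 0" "\<rho> powr q = \<bar>B\<bar> + 1" using q1 by (auto simp: \<rho>_def powr_powr)
    have Jcont: "continuous_on (cball y \<rho>) J"
      unfolding J_def
    proof (intro continuous_on_diff)
      show "continuous_on (cball y \<rho>) (\<lambda>x. \<Psi> (max a (u x)))"
        by (rule continuous_on_compose2[OF Psi_cont])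
          (auto intro!: continuous_intros continuous_on_subset[OF ucont])
      show "continuous_on (cball y \<rho>) (\<lambda>x. norm (x - y) powr q)"
        by (rule continuous_on_powr') (use q1 in \<open>auto intro!: continuous_intros\<close>)
    qed
    obtain x0 where x0: "x0 \<in> cball y \<rho>" and mx: "\<And>x. x \<in> cball y \<rho> \<Longrightarrow> J x \<le> J x0"
      using continuous_attains_sup[OF compact_cball _ Jcont] rho by auto
    have "0 < J y" using y Psi_pos[of "u y"] q1 by (auto simp: J_def U_def max_def)
    also have "J y \<le> J x0" using rho by (intro mx) auto
    finally have J0: "0 < J x0" .
    then have P0: "norm (x0 - y) powr q < \<Psi> (max a (u x0))" by (simp add: J_def)
    have ux0: "a < u x0"
    proof (rule ccontr)
      assume "\<not> a < u x0"
      then have "max a (u x0) = a" by simp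
      then show False using P0 powr_ge_zero[of "norm (x0 - y)" q] by (simp add: Psi_a)
    qed
    then have P0': "norm (x0 - y) powr q < \<Psi> (u x0)" using P0 by (simp add: max_def)
    have "norm (x0 - y) \<noteq> \<rho>" using P0' rho(2) bound[OF ux0] by auto
    then have x0b: "x0 \<in> ball y \<rho>" using x0 by (auto simp: dist_norm norm_minus_commute)
    let ?S = "ball y \<rho> \<inter> U"
    have S: "open ?S" "x0 \<in> ?S" using U x0b ux0 by (auto simp: U_def)
    have mx': "\<Psi> (u x) - norm (x - y) powr q \<le> \<Psi> (u x0) - norm (x0 - y) powr q" if "x \<in> ?S" for x
      using mx[of x] that ux0 by (auto simp: J_def U_def max_def)
    show "grad u y = 0"
    \<comment> \<open>An off-centre maximum contradicts \<open>ineq\<close>; at a maximum in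
      \<open>y\<close> the gradient vanishes, because |x - y|^q has zero derivative at its
      centre.\<close>
    proof (cases "x0 = y")
      case False
      note T = p_laplacian_touching[OF p q reg S False, of k \<Psi>]
      have T1: "norm (grad u x0) = k (u x0) * norm (x0 - y) powr (q - 1)"
        by (rule T(1)) (use k_pos dPsi dk ux0 mx' in \<open>auto simp: U_def\<close>)
      have T2: "p_laplacian p u x0 \<le> DIM('a) * k (u x0) powr (p - 1)
            + (p - 1) * k (u x0) powr (p - 1) * k' (u x0) * norm (x0 - y) powr q"
        by (rule T(2)) (use k_pos dPsi dk ux0 mx' in \<open>auto simp: U_def\<close>)
      have "f (u x0) - g (norm (grad u x0)) \<le> p_laplacian p u x0"
        using sub by (auto simp: plap_subsolution_def)
      then show ?thesis
        using ineq[OF ux0, of "norm (x0 - y)"] T1 T2 False P0' by simp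
    next
      case True
      have "((\<lambda>x. \<Psi> (u x) - norm (x - y) powr q) has_derivative
          (\<lambda>b. (q / k (u y)) * (grad u y \<bullet> b) - 0)) (at y)"
        by (rule has_derivative_diff[OF has_derivative_compose[OF du dPsi[unfolded has_field_derivative_def]]
              has_derivative_norm_powr_0[OF q1]]) (use y in \<open>auto simp: U_def\<close>)
      then have "(\<lambda>b. (q / k (u y)) * (grad u y \<bullet> b) - 0) = (\<lambda>b. 0)"
        by (rule differential_zero_maxmin[rotated 2]) (use S mx' True in auto)
      then have "(q / k (u y)) * (grad u y \<bullet> grad u y) = 0" by (metis diff_zero)
      then show ?thesis using q1 k_pos[of "u y"] y by (auto simp: U_def)
    qed
  qed
  have xU: "x \<in> U" using \<open>\<not> u x \<le> a\<close> by (simp add: U_def)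
  \<comment> \<open>On the open set \<open>U\<close> the flux is identically zero, so the
    subsolution inequality becomes \<open>f (u x) \<le> 0\<close>.\<close>
  have "(plap_flux p u has_derivative (\<lambda>b. 0)) (at x)"
    by (rule has_derivative_transform_within_open[OF has_derivative_const U xU, of 0])
      (simp add: plap_flux_def grad0)
  then have "p_laplacian p u x = 0"
    unfolding p_laplacian_def using divergence_eqI by fastforce
  moreover have "f (u x) - g (norm (grad u x)) \<le> p_laplacian p u x"
    using sub by (auto simp: plap_subsolution_def)
  ultimately show False
    using f_pos[of "u x"] xU grad0[OF xU] g0 by (auto simp: U_def)
qed

section \<open>Monotone nonlinearities and bounded subsolutions\<close>

locale increasing_nonlinearities =
  fixes p q :: real and f g :: "real \<Rightarrow> real"
  assumes p: "1 < p" and q: "q = p / (p - 1)"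
    and f_cont: "continuous_on {0..} f" and f_mono: "strict_mono_on {0..} f" and f0: "f 0 = 0"
    and g_cont: "continuous_on {0..} g" and g_mono: "strict_mono_on {0..} g" and g0: "g 0 = 0"
begin

lemma q_gt_1: "1 < q" and conjugate: "p * q = p + q"
  using p by (auto simp: q field_simps)

lemma f_less: "0 \<le> s \<Longrightarrow> s < t \<Longrightarrow> f s < f t"
  using f_mono by (auto simp: strict_mono_on_def)

lemma f_le: "0 \<le> s \<Longrightarrow> s \<le> t \<Longrightarrow> f s \<le> f t"
  using f_less[of s t] by (cases "s = t") auto

lemma g_less: "0 \<le> s \<Longrightarrow> s < t \<Longrightarrow> g s < g t"
  using g_mono by (auto simp: strict_mono_on_def)

lemma g_le: "0 \<le> s \<Longrightarrow> s \<le> t \<Longrightarrow> g s \<le> g t"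
  using g_less[of s t] by (cases "s = t") auto

lemma f_pos: "0 < s \<Longrightarrow> 0 < f s" and g_pos: "0 < s \<Longrightarrow> 0 < g s"
  using f_less[of 0 s] g_less[of 0 s] by (auto simp: f0 g0)

lemma f_nonneg: "0 \<le> s \<Longrightarrow> 0 \<le> f s" and g_nonneg: "0 \<le> s \<Longrightarrow> 0 \<le> g s"
  using f_le[of 0 s] g_le[of 0 s] by (auto simp: f0 g0)

text \<open>A constant weight \<open>\<kappa>\<close> has no \<open>k'\<close> term, and the bound
  on \<open>u\<close> keeps \<open>\<Psi>\<close> bounded. As \<open>\<kappa>\<close> tends to 0, so
  do \<open>\<kappa> powr (p - 1)\<close> and the gradient at a touching point, whereas
  \<open>f (u x)\<close> stays above \<open>f a > 0\<close>.\<close>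

lemma bounded_subsolution_le:
  fixes u :: "'a::euclidean_space \<Rightarrow> real"
  assumes sub: "plap_subsolution p f g u" and bd: "\<And>x. u x \<le> C" and a: "0 < a"
  shows "u x \<le> a"
proof (cases "C \<le> a")
  case True
  then show ?thesis using bd[of x] by simp
next
  case False
  then have C: "0 < C" using a by simp
  \<comment> \<open>A touching point has \<open>r powr q \<le> q * C / \<kappa>\<close>, hence its
    gradient norm \<open>\<kappa> * r powr (q - 1)\<close> is at most
    \<open>\<kappa> * (q * C / \<kappa>) powr (1 / p)\<close>, which is
    \<open>m \<kappa>\<close>.\<close>
  define m where "m \<kappa> = \<kappa> powr (1 - 1 / p) * (q * C) powr (1 / p)" for \<kappa>
  have ev: "\<forall>\<^sub>F \<kappa> in at_right (0::real). 0 \<le> \<kappa>"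
    by (auto simp: eventually_at_right_field intro: exI[of _ 1])
  have "(m \<longlongrightarrow> 0 powr (1 - 1 / p) * (q * C) powr (1 / p)) (at_right 0)"
    unfolding m_def
    by (intro tendsto_intros tendsto_powr2) (use p ev in auto)
  then have "(m \<longlongrightarrow> 0) (at_right 0)" by simp
  then have "((\<lambda>\<kappa>. g (m \<kappa>)) \<longlongrightarrow> g 0) (at_right 0)"
    using g_cont by (elim continuous_on_tendsto_compose[rotated]) (auto simp: m_def)
  moreover have "((\<lambda>\<kappa>. DIM('a) * \<kappa> powr (p - 1)) \<longlongrightarrow> DIM('a) * 0 powr (p - 1)) (at_right 0)"
    by (intro tendsto_intros tendsto_powr2) (use p ev in auto)
  ultimately have "((\<lambda>\<kappa>. DIM('a) * \<kappa> powr (p - 1) + g (m \<kappa>)) \<longlongrightarrow> DIM('a) * 0 powr (p - 1) + g 0) (at_right 0)"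
    by (intro tendsto_add)
  then have "\<forall>\<^sub>F \<kappa> in at_right 0. DIM('a) * \<kappa> powr (p - 1) + g (m \<kappa>) < f a"
    using f_pos[OF a] p by (intro order_tendstoD(2)) (auto simp: g0)
  moreover have "\<forall>\<^sub>F \<kappa> in at_right (0::real). 0 < \<kappa>" by (simp add: eventually_at_right_less)
  ultimately obtain \<kappa> where \<kappa>: "0 < \<kappa>" "DIM('a) * \<kappa> powr (p - 1) + g (m \<kappa>) < f a"
    using eventually_happens[OF eventually_conj] by (metis (lifting) trivial_limit_at_right_real)
  show ?thesis
  proof (rule subsolution_le_of_bounded_transform[OF p q sub, of a "\<lambda>_. \<kappa>" "\<lambda>_. 0" "\<lambda>s. q / \<kappa> * (s - a)" "q / \<kappa> * C"])
    show "q / \<kappa> * (u x - a) \<le> q / \<kappa> * C" for x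
      using bd[of x] a \<kappa> q_gt_1 by (intro mult_left_mono) auto
    show "real DIM('a) * \<kappa> powr (p - 1) + (p - 1) * \<kappa> powr (p - 1) * 0 * r powr q
           + g (\<kappa> * r powr (q - 1)) < f (u x)"
      if x: "a < u x" and r: "0 < r" "r powr q \<le> q / \<kappa> * (u x - a)" for x r
    proof -
      have "r powr q \<le> q / \<kappa> * C"
        using r(2) bd[of x] a \<kappa> q_gt_1 by (elim order_trans, intro mult_left_mono) auto
      then have "(r powr q) powr (1 / p) \<le> (q / \<kappa> * C) powr (1 / p)"
        using p by (intro powr_mono2) auto
      moreover have "q / p = q - 1" using p by (simp add: q field_simps)
      ultimately have "\<kappa> * r powr (q - 1) \<le> \<kappa> * (q / \<kappa> * C) powr (1 / p)"
        using \<kappa> by (simp add: powr_powr)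
      also have "\<dots> = m \<kappa>"
        using \<kappa> C q_gt_1 by (simp add: m_def powr_diff powr_mult powr_divide)
      finally have "g (\<kappa> * r powr (q - 1)) \<le> g (m \<kappa>)" using \<kappa> by (intro g_le) auto
      moreover have "f a < f (u x)" using a x by (intro f_less) auto
      ultimately show ?thesis using \<kappa>(2) by simp
    qed
    show "continuous_on {a..} (\<lambda>s. q / \<kappa> * (s - a))"
      by (intro continuous_on_mult continuous_on_const continuous_on_diff continuous_on_id)
    show "((\<lambda>s. q / \<kappa> * (s - a)) has_real_derivative q / \<kappa>) (at s)" for s
      using \<kappa> by (auto intro!: derivative_eq_intros)
  qed (use \<kappa> a f_pos in \<open>auto simp: g0\<close>)
qed

end

section \<open>The Keller-Osserman condition\<close>

context increasing_nonlinearities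
begin

abbreviation "F \<equiv> primF f"

lemma F_cont: "continuous_on {0..} F"
  unfolding primF_def by (rule continuous_on_integral_atLeast[OF f_cont])

lemma F_deriv: "0 < s \<Longrightarrow> (F has_real_derivative f s) (at s)"
  unfolding primF_def by (rule has_real_derivative_integral_atLeast[OF f_cont])

lemma F_0: "F 0 = 0" by (simp add: primF_def)

lemma F_less: "0 \<le> s \<Longrightarrow> s < t \<Longrightarrow> F s < F t"
  by (rule deriv_pos_imp_less_atLeast[OF F_cont F_deriv f_pos])

lemma F_pos: "0 < s \<Longrightarrow> 0 < F s"
  using F_less[of 0 s] by (simp add: F_0)

lemma F_nonneg: "0 \<le> s \<Longrightarrow> 0 \<le> F s"
  using F_pos[of s] F_0 by (cases "s = 0") auto

lemma F_le: "0 \<le> s \<Longrightarrow> F s \<le> s * f s"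
proof -
  assume s: "0 \<le> s"
  have "integral {0..s} f \<le> integral {0..s} (\<lambda>_. f s)"
    by (rule integral_le) (use s in \<open>auto intro!: integrable_continuous_interval f_le continuous_on_subset[OF f_cont]\<close>)
  then show ?thesis using s by (simp add: primF_def)
qed

text \<open>Only the right half of the interval is kept, where \<open>g\<close> is at least
  \<open>g s\<close>; this is where the upper limit \<open>2 * s\<close> in \<open>Gam\<close>
  enters.\<close>

lemma g_integral_ge: "0 \<le> s \<Longrightarrow> s * g s \<le> integral {0..2 * s} g"
proof -
  assume s: "0 \<le> s"
  have int: "g integrable_on {a..b}" if "0 \<le> a" for a b
    using that by (auto intro!: integrable_continuous_interval continuous_on_subset[OF g_cont])
  have "s * g s = integral {s..2 * s} (\<lambda>_. g s)" using s by simp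
  also have "\<dots> \<le> integral {s..2 * s} g"
    by (rule integral_le) (use s int in \<open>auto intro!: g_le\<close>)
  also have "\<dots> \<le> integral {0..2 * s} g"
    by (rule integral_subset_le) (use s int g_nonneg in auto)
  finally show ?thesis .
qed

section \<open>The function \<open>\<Gamma>\<close> and its inverse composed with
  \<open>F\<close>\<close>

context
  fixes n :: nat
  assumes n: "1 \<le> n"
begin

abbreviation (input) "\<Gamma> \<equiv> Gam p n g"

lemma Gam_alt: "\<Gamma> s = integral {0..2 * s} g + (p - 1) / p * (q powr p * n) * s powr p"
  by (simp add: Gam_def q)

lemma Gam_0: "\<Gamma> 0 = 0" using p by (simp add: Gam_alt)

lemma Gam_cont: "continuous_on {0..} \<Gamma>"
proof -
  have "continuous_on {0..} (\<lambda>s. integral {0..2 * s} g)"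
    by (rule continuous_on_compose2[OF continuous_on_integral_atLeast[OF g_cont]])
      (auto intro!: continuous_intros)
  moreover have "continuous_on {0..} (\<lambda>s::real. s powr p)"
    by (rule continuous_on_powr') (use p in \<open>auto intro!: continuous_intros\<close>)
  ultimately show ?thesis
    unfolding Gam_alt[abs_def] by (intro continuous_on_add continuous_on_mult_left)
qed

lemma Gam_deriv:
  assumes "0 < s"
  shows "(\<Gamma> has_real_derivative (2 * g (2 * s) + (p - 1) * q powr p * n * s powr (p - 1))) (at s)"
proof -
  have "((\<lambda>s. integral {0..2 * s} g) has_real_derivative (g (2 * s) * 2)) (at s)"
    by (rule DERIV_chain2[OF has_real_derivative_integral_atLeast[OF g_cont]])
      (use assms in \<open>auto intro!: derivative_eq_intros\<close>)
  moreover have "((\<lambda>s. (p - 1) / p * (q powr p * n) * s powr p) has_real_derivative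
      ((p - 1) / p * (q powr p * n) * (p * s powr (p - 1)))) (at s)"
    by (rule DERIV_cmult[OF has_real_derivative_powr[OF assms]])
  ultimately have "((\<lambda>s. integral {0..2 * s} g + (p - 1) / p * (q powr p * n) * s powr p)
      has_real_derivative (g (2 * s) * 2 + (p - 1) / p * (q powr p * n) * (p * s powr (p - 1)))) (at s)"
    by (rule DERIV_add)
  then show ?thesis
    unfolding Gam_alt[abs_def] using p by (simp add: mult_ac)
qed

lemma Gam_deriv_pos:
  "0 < s \<Longrightarrow> 0 < 2 * g (2 * s) + (p - 1) * q powr p * n * s powr (p - 1)"
  using g_pos[of "2 * s"] p q_gt_1 by (intro add_pos_nonneg) auto

lemma Gam_strict_mono: "strict_mono_on {0..} \<Gamma>"
proof (rule strict_mono_onI)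
  fix r s :: real assume "r \<in> {0..}" "s \<in> {0..}" "r < s"
  then show "\<Gamma> r < \<Gamma> s"
    by (intro deriv_pos_imp_less_atLeast[OF Gam_cont Gam_deriv Gam_deriv_pos]) auto
qed

lemma Gam_ge_g: "0 \<le> s \<Longrightarrow> s * g s \<le> \<Gamma> s"
  using g_integral_ge[of s] p q_gt_1 unfolding Gam_alt
  by (simp add: add_increasing2)

lemma Gam_ge_powr: "0 \<le> s \<Longrightarrow> (p - 1) / p * (q powr p * n) * s powr p \<le> \<Gamma> s"
  using g_integral_ge[of s] g_nonneg[of s] mult_nonneg_nonneg[of s "g s"] unfolding Gam_alt
  by linarith

lemma Gam_image: "\<Gamma> ` {0..} = {0..}"
proof (rule image_atLeast0_unbounded[OF Gam_cont Gam_strict_mono Gam_0])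
  fix y
  have g1: "g 1 > 0" by (simp add: g_pos)
  \<comment> \<open>For \<open>s \<ge> 1\<close> the value \<open>\<Gamma> s\<close> is at least
    \<open>s * g 1\<close>, which is unbounded; so \<open>\<Gamma>\<close> is onto and its inverse
    is defined at every value of \<open>F\<close>.\<close>
  define s where "s = max 1 (y / g 1)"
  have "y \<le> s * g 1" using g1 by (simp add: s_def max_def field_simps)
  also have "\<dots> \<le> s * g s" by (intro mult_left_mono g_le) (auto simp: s_def)
  also have "\<dots> \<le> \<Gamma> s" by (rule Gam_ge_g) (simp add: s_def)
  finally show "\<exists>s\<ge>0. y \<le> \<Gamma> s" by (intro exI[of _ s]) (auto simp: s_def)
qed

abbreviation (input) "k \<equiv> \<lambda>s. inv0 \<Gamma> (F s)"

lemma Gam_k: assumes "0 \<le> s" shows "\<Gamma> (k s) = F s" "0 \<le> k s"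
proof -
  have "F s \<in> \<Gamma> ` {0..}" using F_nonneg[OF assms] by (simp add: Gam_image)
  then obtain t where "0 \<le> t" "F s = \<Gamma> t" by auto
  then show "\<Gamma> (k s) = F s" "0 \<le> k s" using inv0_strict_mono[OF Gam_strict_mono] by auto
qed

lemma k_pos: "0 < s \<Longrightarrow> 0 < k s"
  using Gam_k[of s] F_pos[of s] Gam_0 by (cases "k s = 0") auto

lemma k_cont: "continuous_on {0..} k"
  by (rule continuous_on_compose2[OF continuous_on_inv0[OF Gam_strict_mono] F_cont])
    (auto simp: Gam_image F_nonneg)

lemma k_mono: assumes "0 \<le> s" "s \<le> t" shows "k s \<le> k t"
proof (rule ccontr)
  assume "\<not> k s \<le> k t"
  then have "\<Gamma> (k t) < \<Gamma> (k s)"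
    by (intro strict_mono_onD[OF Gam_strict_mono]) (use Gam_k(2) assms in auto)
  then have "F t < F s" using assms by (simp add: Gam_k)
  then show False using F_less[of s t] assms by (cases "s = t") auto
qed

text \<open>The quotient of the derivative of \<open>F\<close> by that of \<open>\<Gamma>\<close> at
  \<open>k s\<close>, as obtained by differentiating \<open>\<Gamma> (k s) = F s\<close>.\<close>

definition "k' s = f s / (2 * g (2 * k s) + (p - 1) * q powr p * n * k s powr (p - 1))"

lemma k_deriv: assumes "0 < s" shows "(k has_real_derivative k' s) (at s)"
proof -
  have Fs: "F s > 0" using F_pos[OF assms] .
  have "(inv0 \<Gamma> has_real_derivative inverse (2 * g (2 * k s) + (p - 1) * q powr p * n * k s powr (p - 1))) (at (F s))"
  proof (rule DERIV_inverse_function[of \<Gamma>, where a = 0 and b = "F s + 1"])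
    show "(\<Gamma> has_real_derivative (2 * g (2 * k s) + (p - 1) * q powr p * n * k s powr (p - 1))) (at (inv0 \<Gamma> (F s)))"
      by (rule Gam_deriv[OF k_pos[OF assms]])
    show "2 * g (2 * k s) + (p - 1) * q powr p * n * k s powr (p - 1) \<noteq> 0"
      using Gam_deriv_pos[OF k_pos[OF assms]] by simp
    show "\<Gamma> (inv0 \<Gamma> y) = y" if "0 < y" "y < F s + 1" for y
    proof -
      have "y \<in> \<Gamma> ` {0..}" using that by (simp add: Gam_image)
      then show ?thesis using inv0_strict_mono[OF Gam_strict_mono] by auto
    qed
    have "continuous_on {0<..} (inv0 \<Gamma>)"
      using continuous_on_inv0[OF Gam_strict_mono] by (rule continuous_on_subset) (auto simp: Gam_image)
    then show "isCont (inv0 \<Gamma>) (F s)"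
      using Fs by (simp add: continuous_on_eq_continuous_at)
  qed (use Fs in auto)
  from DERIV_chain2[OF this F_deriv[OF assms]]
  show ?thesis by (simp add: k'_def divide_inverse mult.commute)
qed

text \<open>Dropping the \<open>g\<close> part of the denominator leaves the power part, whose
  constant makes the \<open>k'\<close> term at most the fraction \<open>1 / (q powr p * n)\<close>
  of \<open>f s\<close>. That fraction is below 1, which leaves room for the other two terms of the
  touching inequality.\<close>

lemma k'_bound: assumes "0 < s" shows "0 \<le> k' s" "(p - 1) * k s powr (p - 1) * k' s \<le> f s / (q powr p * n)"
proof -
  have ks: "0 < k s" using k_pos[OF assms] .
  have fs: "0 < f s" using f_pos[OF assms] .
  have gs: "0 \<le> g (2 * k s)" using g_nonneg ks by simp
  have d: "0 < (p - 1) * q powr p * n * k s powr (p - 1)" using p q_gt_1 n ks by simp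
  show "0 \<le> k' s" using Gam_deriv_pos[OF ks] fs by (simp add: k'_def)
  have "(p - 1) * k s powr (p - 1) * k' s \<le> (p - 1) * k s powr (p - 1) * (f s / ((p - 1) * q powr p * n * k s powr (p - 1)))"
    unfolding k'_def using p fs gs d by (intro mult_left_mono divide_left_mono) (auto intro!: mult_pos_pos add_nonneg_pos)
  also have "\<dots> = f s / (q powr p * n)" using p ks by simp
  finally show "(p - 1) * k s powr (p - 1) * k' s \<le> f s / (q powr p * n)" .
qed

text \<open>The value \<open>\<Gamma> (k s) = F s\<close> lies between \<open>k s * g (k s)\<close>
  and \<open>s * f s\<close>; the power part of \<open>\<Gamma>\<close> yields the companion bound
  \<open>k_powr_le\<close>. Both carry the factor \<open>s / k s\<close> in front of
  \<open>f s\<close>, which is small for large \<open>s\<close> under the integral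
  condition.\<close>

lemma g_k_le: assumes "0 < s" shows "g (k s) \<le> s / k s * f s"
proof -
  have "k s * g (k s) \<le> s * f s"
    using Gam_ge_g[OF Gam_k(2)] Gam_k(1) F_le assms by (metis less_imp_le order_trans)
  then show ?thesis using k_pos[OF assms] by (simp add: field_simps)
qed

lemma k_powr_le: assumes "0 < s"
  shows "n * k s powr (p - 1) \<le> n / ((p - 1) / p * (q powr p * n)) * (s / k s * f s)"
proof -
  let ?c = "(p - 1) / p * (q powr p * n)"
  have c: "?c > 0" using p q_gt_1 n by (intro mult_pos_pos divide_pos_pos) auto
  have ks: "0 < k s" using k_pos[OF assms] .
  have "?c * (k s powr (p - 1) * k s) = ?c * k s powr p" using ks by (simp add: powr_diff)
  also have "\<dots> \<le> \<Gamma> (k s)" by (rule Gam_ge_powr[OF less_imp_le[OF ks]])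
  also have "\<dots> = F s" by (rule Gam_k(1)) (use assms in simp)
  also have "\<dots> \<le> s * f s" by (rule F_le) (use assms in simp)
  finally have "k s powr (p - 1) * (?c * k s) \<le> s * f s" by (simp only: mult_ac)
  then have "k s powr (p - 1) \<le> s * f s / (?c * k s)"
    by (subst pos_le_divide_eq[OF mult_pos_pos[OF c ks]])
  then have "n * k s powr (p - 1) \<le> n * (s * f s / (?c * k s))"
    by (intro mult_left_mono) auto
  also have "\<dots> = n / ?c * (s / k s * f s)" by (simp only: times_divide_eq_left times_divide_eq_right divide_divide_eq_left mult_ac)
  finally show ?thesis .
qed

text \<open>Since \<open>1 / k\<close> is nonincreasing, its integral over \<open>{s/2..s}\<close>
  dominates \<open>s / 2 * (1 / k s)\<close>; so convergence yields pointwise smallness of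
  \<open>s / k s\<close> besides the small tail.\<close>

lemma keller_osserman_tail:
  assumes fin: "(\<integral>\<^sup>+ s\<in>{1..}. ennreal (1 / k s) \<partial>lborel) < \<infinity>" and e: "0 < e"
  obtains a where "1 \<le> a" "\<And>s. a \<le> s \<Longrightarrow> integral {a..s} (\<lambda>s. 1 / k s) \<le> e"
    "\<And>s. a \<le> s \<Longrightarrow> s / k s \<le> 2 * e"
proof -
  have pos: "0 < 1 / k s" if "1 \<le> s" for s using k_pos[of s] that by simp
  have cont: "continuous_on {1..} (\<lambda>s. 1 / k s)"
  proof (rule continuous_on_divide[OF continuous_on_const continuous_on_subset[OF k_cont]])
    show "\<forall>s\<in>{1..}. k s \<noteq> 0"
    proof
      fix s :: real assume "s \<in> {1..}"
      then show "k s \<noteq> 0" using k_pos[of s] by simp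
    qed
  qed auto
  have int: "(\<lambda>s. 1 / k s) integrable_on {a..b}" if "1 \<le> a" for a b
    using that by (auto intro!: integrable_continuous_interval continuous_on_subset[OF cont])
  define I where "I s = integral {1..s} (\<lambda>s. 1 / k s)" for s
  obtain B where B: "\<And>s. 1 \<le> s \<Longrightarrow> I s \<le> B"
    unfolding I_def by (rule nn_integral_atLeast_finite_imp_bounded[OF cont _ fin]) (use pos in \<open>auto simp: less_imp_le\<close>)
  have bdd: "bdd_above (I ` {1..})" using B by (intro bdd_aboveI2[of _ _ B]) auto
  \<comment> \<open>At \<open>A\<close> the bounded primitive \<open>I\<close> is within
    \<open>e\<close> of its supremum, so at most \<open>e\<close> can be gained beyond
    \<open>A\<close>.\<close>
  obtain A where A: "1 \<le> A" "(SUP s\<in>{1..}. I s) - e < I A"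
    using less_cSUP_iff[OF _ bdd, of "(SUP s\<in>{1..}. I s) - e"] e by auto
  have tail: "integral {a..s} (\<lambda>s. 1 / k s) \<le> e" if "A \<le> a" "a \<le> s" for a s
  proof -
    have "integral {a..s} (\<lambda>s. 1 / k s) \<le> integral {A..s} (\<lambda>s. 1 / k s)"
      by (rule integral_subset_le) (use that A int pos in \<open>auto simp: less_imp_le\<close>)
    also have "\<dots> = I s - I A"
      unfolding I_def using A that int
      by (subst Henstock_Kurzweil_Integration.integral_combine[symmetric, of 1 A s]) auto
    also have "\<dots> \<le> e"
      using cSUP_upper[OF _ bdd, of s] A that by auto
    finally show ?thesis .
  qed
  show ?thesis
  \<comment> \<open>The factor 2 keeps \<open>s / 2\<close> beyond \<open>A\<close>.\<close>
  proof (rule that[of "2 * A"])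
    show "s / k s \<le> 2 * e" if s: "2 * A \<le> s" for s
    proof -
      have "s / 2 * (1 / k s) = integral {s/2..s} (\<lambda>_. 1 / k s)" using s A by simp
      also have "\<dots> \<le> integral {s/2..s} (\<lambda>s. 1 / k s)"
        by (rule integral_le) (use s A int k_pos in \<open>auto intro!: divide_left_mono k_mono mult_pos_pos\<close>)
      also have "\<dots> \<le> e" by (rule tail) (use s A in auto)
      finally show ?thesis by simp
    qed
  qed (use A tail in auto)
qed

end

text \<open>For touching radii \<open>r \<le> 1\<close>, each of the three terms of the touching
  inequality is a fraction of \<open>f (u x)\<close>: at most \<open>1 - \<theta>\<close> for the
  \<open>k'\<close> term, \<open>2 * e * c\<close> for the dimension term and \<open>2 * e\<close>
  for the \<open>g\<close> term. The choice of \<open>e\<close> makes these add up to less than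
  1.\<close>

lemma keller_osserman_subsolution_bounded:
  fixes u :: "'a::euclidean_space \<Rightarrow> real"
  assumes fin: "(\<integral>\<^sup>+ s\<in>{1..}. ennreal (1 / inv0 (Gam p DIM('a) g) (F s)) \<partial>lborel) < \<infinity>"
    and sub: "plap_subsolution p f g u"
  shows "\<exists>a. \<forall>x. u x \<le> a"
proof -
  let ?n = "DIM('a)"
  have n: "1 \<le> ?n" by (simp add: Suc_le_eq)
  let ?k = "\<lambda>s. inv0 (Gam p ?n g) (F s)"
  define c where "c = ?n / ((p - 1) / p * (q powr p * ?n))"
  \<comment> \<open>\<open>c\<close> is the factor from \<open>k_powr_le\<close>, and
    \<open>\<theta>\<close> is the share of \<open>f\<close> that the \<open>k'\<close> term leaves
    over.\<close>
  define \<theta> where "\<theta> = 1 - 1 / (q powr p * ?n)"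
  have "1 < q powr p" using q_gt_1 p by (simp add: gr_one_powr)
  then have "1 < q powr p * ?n" using n by (smt (verit) mult_le_cancel_left1 of_nat_1 of_nat_le_iff)
  then have th: "0 < \<theta>" by (simp add: \<theta>_def)
  have c: "0 \<le> c" using p q_gt_1 by (simp add: c_def)
  \<comment> \<open>The first bound gives \<open>\<Psi> \<le> 1\<close>, hence touching radii at
    most 1; the second lets the two remaining terms take at most half of the share
    \<open>\<theta>\<close>.\<close>
  define e where "e = min (1 / q) (\<theta> / (4 * (c + 1)))"
  have e: "0 < e" "q * e \<le> 1" "2 * e * (c + 1) < \<theta>"
  proof -
    show "0 < e" using th c q_gt_1 by (simp add: e_def)
    have "q * e \<le> q * (1 / q)" using q_gt_1 by (intro mult_left_mono) (auto simp: e_def)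
    then show "q * e \<le> 1" using q_gt_1 by simp
    have "2 * e * (c + 1) \<le> 2 * (\<theta> / (4 * (c + 1))) * (c + 1)"
      using c by (intro mult_right_mono mult_left_mono) (auto simp: e_def)
    also have "\<dots> = \<theta> / 2" using c by (simp add: field_simps)
    also have "\<dots> < \<theta>" using th by simp
    finally show "2 * e * (c + 1) < \<theta>" .
  qed
  obtain a where a: "1 \<le> a" and tail: "\<And>s. a \<le> s \<Longrightarrow> integral {a..s} (\<lambda>s. 1 / ?k s) \<le> e"
    and sk: "\<And>s. a \<le> s \<Longrightarrow> s / ?k s \<le> 2 * e"
    using keller_osserman_tail[OF n fin e(1)] by metis
  have cont: "continuous_on {a..} (\<lambda>s. q / ?k s)"
  proof (rule continuous_on_divide[OF continuous_on_const continuous_on_subset[OF k_cont[OF n]]])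
    show "\<forall>s\<in>{a..}. ?k s \<noteq> 0"
    proof
      fix s assume "s \<in> {a..}"
      then show "?k s \<noteq> 0" using k_pos[OF n, of s] a by simp
    qed
  qed (use a in auto)
  define \<Psi> where "\<Psi> s = integral {a..s} (\<lambda>s. q / ?k s)" for s
  have Psi: "\<Psi> s = q * integral {a..s} (\<lambda>s. 1 / ?k s)" for s
    unfolding \<Psi>_def by (subst integral_mult_right[symmetric]) simp
  have Psi1: "\<Psi> s \<le> 1" if "a \<le> s" for s
    unfolding Psi using mult_left_mono[OF tail[OF that], of q] e(2) q_gt_1 by linarith
  have "u x \<le> a" for x
  proof (rule subsolution_le_of_bounded_transform[OF p q sub, of a ?k "k' ?n" \<Psi> 1])
    show "real ?n * ?k (u x) powr (p - 1) + (p - 1) * ?k (u x) powr (p - 1) * k' ?n (u x) * r powr q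
           + g (?k (u x) * r powr (q - 1)) < f (u x)"
      if x: "a < u x" and r: "0 < r" "r powr q \<le> \<Psi> (u x)" for x r
    proof -
      let ?s = "u x"
      have s: "0 < ?s" using x a by simp
      note kp = k_pos[OF n s]
      have fs: "0 < f ?s" using f_pos[OF s] .
      have rq: "r powr q \<le> 1" using r Psi1[of ?s] x by simp
      have r1: "r \<le> 1"
      proof (rule ccontr)
        assume "\<not> r \<le> 1"
        then have "1 < r powr q" using q_gt_1 by (simp add: gr_one_powr)
        then show False using rq by simp
      qed
      have rq1: "r powr (q - 1) \<le> 1" using r r1 q_gt_1 by (intro powr_le1) auto
      have t1: "real ?n * ?k ?s powr (p - 1) \<le> c * (2 * e * f ?s)"
        using k_powr_le[OF n s] mult_left_mono[OF mult_right_mono[OF sk[of ?s], of "f ?s"] c] x fs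
        by (simp add: c_def)
      have "(p - 1) * ?k ?s powr (p - 1) * k' ?n ?s * r powr q \<le> (p - 1) * ?k ?s powr (p - 1) * k' ?n ?s * 1"
        using rq p k'_bound(1)[OF n s] by (intro mult_left_mono) auto
      then have t2: "(p - 1) * ?k ?s powr (p - 1) * k' ?n ?s * r powr q \<le> f ?s / (q powr p * ?n)"
        using k'_bound(2)[OF n s] by simp
      have "g (?k ?s * r powr (q - 1)) \<le> g (?k ?s)"
        using kp rq1 by (intro g_le) (auto intro!: mult_left_le)
      then have t3: "g (?k ?s * r powr (q - 1)) \<le> 2 * e * f ?s"
        using g_k_le[OF n s] mult_right_mono[OF sk[of ?s], of "f ?s"] x fs by simp
      have "2 * e * (c + 1) * f ?s < \<theta> * f ?s" using e(3) fs by simp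
      then show ?thesis using t1 t2 t3 by (simp add: \<theta>_def algebra_simps)
    qed
    show "continuous_on {a..} \<Psi>" unfolding \<Psi>_def by (rule continuous_on_integral_atLeast[OF cont])
    show "(\<Psi> has_real_derivative q / ?k s) (at s)" if "a < s" for s
      unfolding \<Psi>_def by (rule has_real_derivative_integral_atLeast[OF cont that])
  qed (use a f_pos g0 k_pos[OF n] k_deriv[OF n] Psi1 in \<open>auto simp: \<Psi>_def\<close>)
  then show ?thesis by blast
qed

lemma keller_osserman_liouville:
  fixes u :: "'a::euclidean_space \<Rightarrow> real"
  assumes fin: "(\<integral>\<^sup>+ s\<in>{1..}. ennreal (1 / inv0 (Gam p DIM('a) g) (F s)) \<partial>lborel) < \<infinity>"
    and sub: "plap_subsolution p f g u" and nonneg: "\<And>x. 0 \<le> u x"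
  shows "u x = 0"
proof -
  obtain C where C: "\<And>x. u x \<le> C" using keller_osserman_subsolution_bounded[OF fin sub] by auto
  \<comment> \<open>Boundedness brings in the constant weights, which push the level
    \<open>a\<close> down to every positive number.\<close>
  have "u x \<le> 0"
    by (rule dense_ge) (rule bounded_subsolution_le[OF sub C])
  then show ?thesis using nonneg[of x] by simp
qed

end

section \<open>Existence for the radial equation\<close>

text \<open>Tonelli's method: the approximate solutions depend on their own past with a delay \<open>\<delta>\<close>.
  Here \<open>n\<close> is the space dimension minus one, and division by zero makes \<open>A h r = 0\<close> for \<open>r \<le> 0\<close>.\<close>
locale radial_volterra =
  fixes n :: nat and W :: "(real \<Rightarrow> real) \<Rightarrow> real \<Rightarrow> real" and B :: "real \<Rightarrow> real"
  assumes causal: "\<And>h1 h2 r. \<lbrakk>0 \<le> r; \<And>s. \<lbrakk>0 \<le> s; s \<le> r\<rbrakk> \<Longrightarrow> h1 s = h2 s\<rbrakk> \<Longrightarrow> W h1 r = W h2 r"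
    and W_cont: "\<And>h. continuous_on {0..} h \<Longrightarrow> continuous_on {0..} (W h)"
    and W_bound: "\<And>h r. \<lbrakk>continuous_on {0..} h; 0 \<le> r\<rbrakk> \<Longrightarrow> \<bar>W h r\<bar> \<le> B r"
    and B_mono: "\<And>r s. \<lbrakk>0 \<le> r; r \<le> s\<rbrakk> \<Longrightarrow> B r \<le> B s"
    and W_lim: "\<And>H h r. \<lbrakk>0 \<le> r; \<And>k. continuous_on {0..} (H k); continuous_on {0..} h;
        \<And>s. 0 \<le> s \<Longrightarrow> (\<lambda>k. H k s) \<longlonglongrightarrow> h s\<rbrakk> \<Longrightarrow> (\<lambda>k. W (H k) r) \<longlonglongrightarrow> W h r"
begin

text \<open>Integrated form of (r^n h)' = r^n W h, equivalently h' + n h / r = W h with h(0) = 0;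
  its fixed points are the radial solutions.\<close>

definition "A h r = integral {0..r} (\<lambda>s. s ^ n * W h s) / r ^ n"

lemma B_nonneg: "0 \<le> r \<Longrightarrow> 0 \<le> B r"
  using order_trans[OF abs_ge_zero W_bound[OF continuous_on_const]] .

text \<open>For \<open>r < 0\<close> the interval of integration is empty. The extension by zero
  makes the delayed equation start from zero data.\<close>

lemma A_nonpos: "r \<le> 0 \<Longrightarrow> A h r = 0"
  by (cases "r = 0") (auto simp: A_def)

lemma A_causal: "(\<And>s. \<lbrakk>0 \<le> s; s \<le> r\<rbrakk> \<Longrightarrow> h1 s = h2 s) \<Longrightarrow> A h1 r = A h2 r"
  unfolding A_def
  by (intro arg_cong2[of _ _ _ _ "(/)"] integral_cong arg_cong2[of _ _ _ _ "(*)"] causal) auto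

context
  fixes h :: "real \<Rightarrow> real" assumes h: "continuous_on {0..} h"
begin

lemma cont_integrand: "continuous_on {0..} (\<lambda>s. s ^ n * W h s)"
  by (intro continuous_intros W_cont[OF h])

lemma integrable_integrand: "(\<lambda>s. s ^ n * W h s) integrable_on {0..r}"
  by (intro integrable_continuous_interval continuous_on_subset[OF cont_integrand]) auto

lemma A_bound: assumes r: "0 \<le> r" shows "\<bar>A h r\<bar> \<le> r * B r"
proof (cases "r = 0")
  case True then show ?thesis by (simp add: A_nonpos)
next
  case False
  then have r: "0 < r" using r by simp
  have "norm (integral {0..r} (\<lambda>s. s ^ n * W h s)) \<le> integral {0..r} (\<lambda>s. r ^ n * B r)"
  proof (rule integral_norm_bound_integral[OF integrable_integrand])
    fix s assume s: "s \<in> {0..r}"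
    have "\<bar>s ^ n * W h s\<bar> \<le> r ^ n * B r"
      unfolding abs_mult using s W_bound[OF h, of s] B_mono[of s r]
      by (intro mult_mono) (auto intro!: power_mono simp: power_abs[symmetric])
    then show "norm (s ^ n * W h s) \<le> r ^ n * B r" by simp
  qed auto
  then show ?thesis using r by (simp add: A_def field_simps)
qed

lemma A_deriv: assumes r: "0 < r"
  shows "(A h has_real_derivative (W h r - n * A h r / r)) (at r)"
proof -
  have "((\<lambda>r. integral {0..r} (\<lambda>s. s ^ n * W h s)) has_real_derivative r ^ n * W h r) (at r)"
    by (rule has_real_derivative_integral_atLeast[OF cont_integrand r])
  \<comment> \<open>Writing the derivative as a quotient also covers \<open>n = 0\<close>, where
    \<open>n - 1\<close> would be truncated.\<close>
  moreover have "((\<lambda>r. r ^ n) has_real_derivative (n * r ^ n / r)) (at r)"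
    using r DERIV_pow[of n r] by (cases n) auto
  ultimately have "((\<lambda>r. integral {0..r} (\<lambda>s. s ^ n * W h s) / r ^ n) has_real_derivative
     ((r ^ n * W h r * r ^ n - integral {0..r} (\<lambda>s. s ^ n * W h s) * (n * r ^ n / r)) / (r ^ n * r ^ n))) (at r)"
    by (rule DERIV_divide) (use r in auto)
  moreover have "(r ^ n * W h r * r ^ n - integral {0..r} (\<lambda>s. s ^ n * W h s) * (n * r ^ n / r)) / (r ^ n * r ^ n)
      = W h r - n * A h r / r"
    using r by (simp add: A_def diff_divide_distrib mult.commute)
  ultimately show ?thesis unfolding A_def by simp
qed

text \<open>The derivative W h - n A h / r is at most (n + 1) B R in absolute value, because
  \<open>A_bound\<close> controls the singular quotient. The constant does not depend on
  \<open>h\<close>; this is the equicontinuity behind the compactness argument. The derivative is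
  known at positive arguments only, so \<open>r = 0\<close> is treated by \<open>A_bound\<close>
  directly.\<close>

lemma A_lipschitz:
  assumes "0 \<le> r" "r \<le> s" "s \<le> R"
  shows "\<bar>A h s - A h r\<bar> \<le> (n + 1) * B R * (s - r)"
proof -
  have pos: "\<bar>A h s - A h r\<bar> \<le> (n + 1) * B R * (s - r)" if "0 < r" "r \<le> s" "s \<le> R" for r s
  proof (cases "r = s")
    case False
    then have "r < s" using that by simp
    then have "\<exists>z>r. z < s \<and> A h s - A h r = (s - r) * (W h z - n * A h z / z)"
      by (rule MVT2) (use A_deriv that in auto)
    then obtain z where z: "r < z" "z < s" "A h s - A h r = (s - r) * (W h z - n * A h z / z)"
      by blast
    have z0: "0 < z" using z that by simp
    have "\<bar>A h z\<bar> / z \<le> B z" using A_bound[of z] z0 by (simp add: field_simps)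
    then have "n * (\<bar>A h z\<bar> / z) \<le> n * B z" by (intro mult_left_mono) auto
    moreover have "\<bar>W h z - n * A h z / z\<bar> \<le> \<bar>W h z\<bar> + n * (\<bar>A h z\<bar> / z)"
      using abs_triangle_ineq4[of "W h z" "n * A h z / z"] z0 by (simp add: abs_mult)
    moreover have "\<bar>W h z\<bar> \<le> B z" using W_bound[OF h] z0 by simp
    ultimately have "\<bar>W h z - n * A h z / z\<bar> \<le> (n + 1) * B z" by (simp add: algebra_simps)
    also have "\<dots> \<le> (n + 1) * B R" using z0 z that by (intro mult_left_mono B_mono) auto
    finally have "(s - r) * \<bar>W h z - n * A h z / z\<bar> \<le> (s - r) * ((n + 1) * B R)"
      using that by (intro mult_left_mono) auto
    then show ?thesis using that by (simp add: z(3) abs_mult mult_ac)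
  qed auto
  show ?thesis
  proof (cases "r = 0")
    case True
    have "\<bar>A h s\<bar> \<le> s * B s" using assms True by (intro A_bound) auto
    also have "\<dots> \<le> s * ((n + 1) * B R)"
    proof (intro mult_left_mono)
      have "B s \<le> 1 * B R" using B_mono[of s R] assms True by simp
      also have "\<dots> \<le> (n + 1) * B R" using B_nonneg[of R] assms True by (intro mult_right_mono) auto
      finally show "B s \<le> (n + 1) * B R" .
    qed (use assms True in auto)
    finally show ?thesis using True by (simp add: A_nonpos mult_ac)
  qed (use pos assms in auto)
qed

lemma A_cont: "continuous_on UNIV (A h)"
proof (rule continuous_at_imp_continuous_on, rule ballI)
  fix r :: real
  let ?L = "(n + 1) * B (\<bar>r\<bar> + 1)"
  have L: "0 \<le> ?L" by (intro mult_nonneg_nonneg B_nonneg) auto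
  have "\<bar>A h s - A h r\<bar> \<le> ?L * \<bar>s - r\<bar>" if "\<bar>s - r\<bar> < 1" for s
  proof -
    have A0: "A h x = A h (max 0 x)" for x using A_nonpos[of x h] A_nonpos[of 0 h] by (cases "0 \<le> x") auto
    have "\<bar>A h (max 0 s) - A h (max 0 r)\<bar> \<le> ?L * \<bar>max 0 s - max 0 r\<bar>"
    proof (cases "max 0 s \<le> max 0 r")
      case True
      have "\<bar>A h (max 0 r) - A h (max 0 s)\<bar> \<le> ?L * (max 0 r - max 0 s)"
        by (rule A_lipschitz) (use True in auto)
      then show ?thesis using True by (simp only: abs_minus_commute abs_of_nonneg diff_ge_0_iff_ge)
    next
      case False
      have "\<bar>A h (max 0 s) - A h (max 0 r)\<bar> \<le> ?L * (max 0 s - max 0 r)"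
        by (rule A_lipschitz) (use False that in auto)
      then show ?thesis using False by (simp only: abs_of_nonneg diff_ge_0_iff_ge not_le less_imp_le)
    qed
    also have "\<dots> \<le> ?L * \<bar>s - r\<bar>" using L by (intro mult_left_mono) auto
    finally show ?thesis using A0[of s] A0[of r] by simp
  qed
  then have "\<forall>\<^sub>F s in at r. norm (A h s - A h r) \<le> norm (s - r) * ?L"
    unfolding eventually_at by (intro exI[of _ 1]) (auto simp: dist_real_def mult.commute)
  moreover have "((\<lambda>s. s - r) \<longlongrightarrow> 0) (at r)" by (rule tendsto_eq_intros refl | simp)+
  ultimately have "((\<lambda>s. A h s - A h r) \<longlongrightarrow> 0) (at r)"
    by (rule tendsto_0_le[rotated])
  then show "isCont (A h) r" by (simp add: isCont_def LIM_zero_iff)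
qed

end

text \<open>Method of steps: the value at \<open>r\<close> depends on the preceding iterate only up
  to \<open>r - \<delta>\<close>, so the iterate with index \<open>j\<close> is final at all
  arguments up to \<open>j * \<delta>\<close>.\<close>

primrec delayed :: "real \<Rightarrow> nat \<Rightarrow> real \<Rightarrow> real" where
  "delayed \<delta> 0 = (\<lambda>r. 0)"
| "delayed \<delta> (Suc j) = (\<lambda>r. A (delayed \<delta> j) (r - \<delta>))"

lemma delayed_cont: "continuous_on S (delayed \<delta> j)"
proof (induction j arbitrary: S)
  case (Suc j)
  show ?case unfolding delayed.simps
    by (rule continuous_on_compose2[OF A_cont[OF Suc]]) (auto intro!: continuous_intros)
qed simp

lemma delayed_stable: "0 < \<delta> \<Longrightarrow> r \<le> j * \<delta> \<Longrightarrow> delayed \<delta> (Suc j) r = delayed \<delta> j r"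
proof (induction j arbitrary: r)
  case 0
  then show ?case by (simp add: A_nonpos)
next
  case (Suc j)
  have "A (delayed \<delta> (Suc j)) (r - \<delta>) = A (delayed \<delta> j) (r - \<delta>)"
    by (rule A_causal) (rule Suc.IH, use Suc.prems in \<open>auto simp: algebra_simps\<close>)
  then show ?case by simp
qed

lemma delayed_eq: assumes "0 < \<delta>" "r \<le> j * \<delta>" "j \<le> i" shows "delayed \<delta> i r = delayed \<delta> j r"
  using assms(3)
proof (induction i rule: dec_induct)
  case (step i)
  have "j * \<delta> \<le> i * \<delta>" using step assms by (intro mult_right_mono) auto
  then have "delayed \<delta> (Suc i) r = delayed \<delta> i r"
    using assms by (intro delayed_stable) linarith+
  then show ?case using step.IH by (rule trans)
qed simp

lemma delayed_solution:
  assumes d: "0 < \<delta>"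
  obtains h where "continuous_on {0..} h" "\<And>r. 0 \<le> r \<Longrightarrow> h r = A h (r - \<delta>)"
proof -
  \<comment> \<open>The index is the least \<open>j\<close> with
    \<open>r \<le> j * \<delta>\<close>, from which on the iterates no longer change at
    \<open>r\<close>.\<close>
  define h where "h r = delayed \<delta> (nat \<lceil>r / \<delta>\<rceil>) r" for r
  have h_eq: "h r = delayed \<delta> j r" if "0 \<le> r" "r \<le> j * \<delta>" for r j
  proof -
    let ?i = "nat \<lceil>r / \<delta>\<rceil>"
    have "r / \<delta> \<le> ?i" using real_nat_ceiling_ge by blast
    then have 1: "r \<le> ?i * \<delta>" using d by (simp add: field_simps)
    have "r / \<delta> \<le> j" using that d by (simp add: field_simps)
    then have "?i \<le> j" by (simp add: nat_le_iff ceiling_le_iff)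
    then show ?thesis using delayed_eq[OF d 1] by (simp add: h_def)
  qed
  have ex: "\<exists>j. r < real j * \<delta>" for r using reals_Archimedean3[OF d] by (metis)
  have cont: "continuous_on {0..} h"
    unfolding continuous_on_eq_continuous_within
  proof
    fix r :: real assume r: "r \<in> {0..}"
    obtain j where j: "r < real j * \<delta>" using ex by blast
    have "continuous_on {0..real j * \<delta>} h"
      using delayed_cont[of "{0..real j * \<delta>}" \<delta> j]
      by (rule continuous_on_cong[THEN iffD1, rotated 2]) (auto simp: h_eq)
    then have "continuous (at r within {0..real j * \<delta>}) h"
      using r j by (auto simp: continuous_on_eq_continuous_within)
    moreover have "at r within {0..real j * \<delta>} = at r within {0..}"
      by (rule at_within_nhd[of _ "{..<real j * \<delta>}"]) (use r j in auto)
    ultimately show "continuous (at r within {0..}) h" by simp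
  qed
  moreover have "h r = A h (r - \<delta>)" if r: "0 \<le> r" for r
  proof -
    obtain j where j: "r < real j * \<delta>" using ex by blast
    have "h r = delayed \<delta> (Suc j) r" by (rule h_eq) (use r j d in \<open>auto simp: algebra_simps\<close>)
    also have "\<dots> = A (delayed \<delta> j) (r - \<delta>)" by simp
    also have "\<dots> = A h (r - \<delta>)" by (rule A_causal) (use h_eq[of _ j] j d in auto)
    finally show ?thesis .
  qed
  ultimately show ?thesis by (rule that)
qed

lemma A_lim:
  assumes "\<And>k. continuous_on {0..} (H k)" "continuous_on {0..} h"
    "\<And>s. 0 \<le> s \<Longrightarrow> (\<lambda>k. H k s) \<longlonglongrightarrow> h s"
  shows "(\<lambda>k. A (H k) r) \<longlonglongrightarrow> A h r"
proof -
  have "(\<lambda>k. integral {0..r} (\<lambda>s. s ^ n * W (H k) s)) \<longlonglongrightarrow> integral {0..r} (\<lambda>s. s ^ n * W h s)"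
  proof (rule dominated_convergence(2))
    show "(\<lambda>s. s ^ n * W (H k) s) integrable_on {0..r}" for k
      by (rule integrable_integrand[OF assms(1)])
    show "norm (s ^ n * W (H k) s) \<le> r ^ n * B r" if s: "s \<in> {0..r}" for k s
      unfolding norm_mult using s W_bound[OF assms(1)[of k], of s] B_mono[of s r]
      by (intro mult_mono) (auto intro!: power_mono simp: norm_power)
    show "(\<lambda>k. s ^ n * W (H k) s) \<longlonglongrightarrow> s ^ n * W h s" if "s \<in> {0..r}" for s
      using that by (intro tendsto_intros W_lim assms) auto
  qed auto
  then show ?thesis unfolding A_def by (simp add: divide_inverse tendsto_mult_right)
qed

text \<open>An Arzela-Ascoli argument by hand: the delayed solutions share their Lipschitz
  constants, a diagonal subsequence converges at the nonnegative rationals, and equicontinuity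
  extends the convergence to the half-line. Dominated convergence, in \<open>A_lim\<close>,
  identifies the limit as a fixed point.\<close>

lemma solution_exists:
  obtains h where "continuous_on {0..} h" "\<And>r. 0 \<le> r \<Longrightarrow> h r = A h r"
proof -
  define \<delta> where "\<delta> k = inverse (real (Suc k))" for k
  have d: "0 < \<delta> k" "\<delta> k \<le> 1" for k by (auto simp: \<delta>_def field_simps)
  have d0: "\<delta> \<longlonglongrightarrow> 0" unfolding \<delta>_def by (rule LIMSEQ_inverse_real_of_nat)
  have "\<exists>h. continuous_on {0..} h \<and> (\<forall>r\<ge>0. h r = A h (r - \<delta> k))" for k
    using delayed_solution[OF d(1)] by metis
  then obtain H where Hc: "\<And>k. continuous_on {0..} (H k)" and HA: "\<And>k r. 0 \<le> r \<Longrightarrow> H k r = A (H k) (r - \<delta> k)"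
    by metis
  have A0: "A (H k) x = A (H k) (max 0 x)" for k x
    using A_nonpos[of x "H k"] A_nonpos[of 0 "H k"] by (cases "0 \<le> x") auto
  have lip': "\<bar>A (H k) y - A (H k) x\<bar> \<le> (n + 1) * B R * (y - x)" if "x \<le> y" "y \<le> R" "0 \<le> R" for k x y R
  proof -
    have "\<bar>A (H k) (max 0 y) - A (H k) (max 0 x)\<bar> \<le> (n + 1) * B R * (max 0 y - max 0 x)"
      by (rule A_lipschitz[OF Hc]) (use that in auto)
    also have "\<dots> \<le> (n + 1) * B R * (y - x)"
      using that B_nonneg[of R] by (intro mult_left_mono) auto
    finally show ?thesis using A0[of k x] A0[of k y] by simp
  qed
  have lip: "\<bar>H k s - H k r\<bar> \<le> (n + 1) * B R * \<bar>s - r\<bar>" if "0 \<le> r" "0 \<le> s" "r \<le> R" "s \<le> R" for k r s R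
    using lip'[of "r - \<delta> k" "s - \<delta> k" R k] lip'[of "s - \<delta> k" "r - \<delta> k" R k] d(1)[of k] that
    by (cases "r \<le> s") (auto simp: HA abs_minus_commute)
  have H0: "H k 0 = 0" for k using d(1)[of k] by (simp add: HA A_nonpos)
  have bd: "\<bar>H k r\<bar> \<le> (n + 1) * B r * r" if "0 \<le> r" for k r
    using lip[of 0 r r k] that by (simp add: H0)
  \<comment> \<open>The selection principle wants one bound for all points; division by
    \<open>(n + 1) * B x * x + 1\<close> normalises \<open>bd\<close> to the bound 1, the last
    summand keeping the divisor positive.\<close>
  obtain \<phi> where \<phi>: "strict_mono (\<phi> :: nat \<Rightarrow> nat)"
    and conv: "\<And>x. x \<in> \<rat> \<inter> {0..} \<Longrightarrow> \<exists>l. (\<lambda>k. H (\<phi> k) x / ((n + 1) * B x * x + 1)) \<longlonglongrightarrow> l"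
  proof (rule function_convergent_subsequence[of "\<rat> \<inter> {0..}" "\<lambda>k x. H k x / ((n + 1) * B x * x + 1)" 1])
    show "countable (\<rat> \<inter> {0..} :: real set)" by (simp add: countable_rat)
    show "norm (H k x / ((n + 1) * B x * x + 1)) \<le> 1" if "x \<in> \<rat> \<inter> {0..}" for k x
    proof -
      have x: "0 \<le> x" using that by simp
      have "0 \<le> (n + 1) * B x * x" using x B_nonneg[OF x] by simp
      then show ?thesis using bd[OF x, of k] by (simp add: field_simps)
    qed
  qed blast
  have convQ: "Cauchy (\<lambda>k. H (\<phi> k) x)" if "x \<in> \<rat>" "0 \<le> x" for x
  proof -
    have "0 \<le> (n + 1) * B x * x" using that B_nonneg[of x] by simp
    then have ne: "(n + 1) * B x * x + 1 \<noteq> 0" by linarith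
    obtain l where "(\<lambda>k. H (\<phi> k) x / ((n + 1) * B x * x + 1)) \<longlonglongrightarrow> l" using conv[of x] \<open>x \<in> \<rat>\<close> \<open>0 \<le> x\<close> by auto
    then have "(\<lambda>k. H (\<phi> k) x / ((n + 1) * B x * x + 1) * ((n + 1) * B x * x + 1)) \<longlonglongrightarrow> l * ((n + 1) * B x * x + 1)"
      by (intro tendsto_intros)
    then have "(\<lambda>k. H (\<phi> k) x) \<longlonglongrightarrow> l * ((n + 1) * B x * x + 1)" using ne by simp
    then show ?thesis by (rule LIMSEQ_imp_Cauchy)
  qed
  have "Cauchy (\<lambda>k. H (\<phi> k) r)" if r: "0 \<le> r" for r
  proof (rule metric_CauchyI)
    fix e :: real assume e: "0 < e"
    define L where "L = (n + 1) * B (r + 1) + 1"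
    have L: "0 < L" using B_nonneg[of "r + 1"] r by (simp add: L_def add_nonneg_pos)
    \<comment> \<open>A rational point so close to \<open>r\<close> that the common Lipschitz
      constant costs less than \<open>e / 3\<close> in passing from \<open>r\<close> to
      \<open>x\<close>, and again in passing back.\<close>
    obtain x where x: "x \<in> \<rat>" "r < x" "x < r + min 1 (e / (3 * L))"
      using Rats_dense_in_real[of r "r + min 1 (e / (3 * L))"] e L by auto
    have close: "\<bar>H k x - H k r\<bar> < e / 3" for k
    proof -
      have "\<bar>H k x - H k r\<bar> \<le> (n + 1) * B (r + 1) * \<bar>x - r\<bar>" by (rule lip) (use x r in auto)
      also have "\<dots> \<le> L * \<bar>x - r\<bar>" by (intro mult_right_mono) (auto simp: L_def)
      also have "\<dots> < L * (e / (3 * L))" using x L by (intro mult_strict_left_mono) auto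
      also have "\<dots> = e / 3" using L by simp
      finally show ?thesis .
    qed
    obtain M where M: "\<And>i j. M \<le> i \<Longrightarrow> M \<le> j \<Longrightarrow> dist (H (\<phi> i) x) (H (\<phi> j) x) < e / 3"
      using metric_CauchyD[OF convQ[OF x(1)], of "e / 3"] x r e by auto
    have "dist (H (\<phi> i) r) (H (\<phi> j) r) < e" if "M \<le> i" "M \<le> j" for i j
      using M[OF that] close[of "\<phi> i"] close[of "\<phi> j"] unfolding dist_real_def by linarith
    then show "\<exists>M. \<forall>m\<ge>M. \<forall>n\<ge>M. dist (H (\<phi> m) r) (H (\<phi> n) r) < e" by blast
  qed
  then have "\<exists>l. (\<lambda>k. H (\<phi> k) r) \<longlonglongrightarrow> l" if "0 \<le> r" for r
    using that by (simp add: Cauchy_convergent_iff convergent_def)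
  then obtain h where h: "\<And>r. 0 \<le> r \<Longrightarrow> (\<lambda>k. H (\<phi> k) r) \<longlonglongrightarrow> h r" by metis
  have hlip: "\<bar>h s - h r\<bar> \<le> (n + 1) * B R * \<bar>s - r\<bar>" if "0 \<le> r" "0 \<le> s" "r \<le> R" "s \<le> R" for r s R
    by (rule LIMSEQ_le_const2[OF tendsto_rabs[OF tendsto_diff[OF h h]]]) (use lip that in auto)
  have hc: "continuous_on {0..} h"
    unfolding continuous_on_def
  proof
    fix r :: real assume r: "r \<in> {0..}"
    have "\<forall>\<^sub>F s in at r within {0..}. norm (h s - h r) \<le> norm (s - r) * ((n + 1) * B (r + 1))"
      unfolding eventually_at using hlip[of r _ "r + 1"] r
      by (intro exI[of _ 1]) (auto simp: dist_real_def mult.commute)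
    moreover have "((\<lambda>s. s - r) \<longlongrightarrow> 0) (at r within {0..})"
      by (rule tendsto_eq_intros refl | simp)+
    ultimately have "((\<lambda>s. h s - h r) \<longlongrightarrow> 0) (at r within {0..})"
      by (rule tendsto_0_le[rotated])
    then show "(h \<longlongrightarrow> h r) (at r within {0..})" by (simp add: LIM_zero_iff)
  qed
  have "h r = A h r" if r: "0 \<le> r" for r
  proof -
    have "(\<lambda>k. A (H (\<phi> k)) r) \<longlonglongrightarrow> A h r" by (rule A_lim[OF Hc hc h])
    \<comment> \<open>Undoing the shift costs at most \<open>(n + 1) * B r\<close> times the delay,
      which vanishes in the limit.\<close>
    moreover have "(\<lambda>k. H (\<phi> k) r - A (H (\<phi> k)) r) \<longlonglongrightarrow> 0"
    proof (rule tendsto_0_le)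
      show "(\<lambda>k. (\<delta> \<circ> \<phi>) k) \<longlonglongrightarrow> 0" using LIMSEQ_subseq_LIMSEQ[OF d0 \<phi>] by (simp only: comp_def)
      show "\<forall>\<^sub>F k in sequentially. norm (H (\<phi> k) r - A (H (\<phi> k)) r) \<le> norm ((\<delta> \<circ> \<phi>) k) * ((n + 1) * B r)"
      proof (rule always_eventually, rule allI)
        fix k
        have "\<bar>A (H (\<phi> k)) r - A (H (\<phi> k)) (r - \<delta> (\<phi> k))\<bar> \<le> (n + 1) * B r * (r - (r - \<delta> (\<phi> k)))"
          by (rule lip') (use r d(1)[of "\<phi> k"] in auto)
        then show "norm (H (\<phi> k) r - A (H (\<phi> k)) r) \<le> norm ((\<delta> \<circ> \<phi>) k) * ((n + 1) * B r)"
          using d(1)[of "\<phi> k"] r by (simp add: HA abs_minus_commute mult.commute)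
      qed
    qed
    ultimately have "(\<lambda>k. (H (\<phi> k) r - A (H (\<phi> k)) r) + A (H (\<phi> k)) r) \<longlonglongrightarrow> 0 + A h r"
      by (intro tendsto_add)
    then have "(\<lambda>k. H (\<phi> k) r) \<longlonglongrightarrow> A h r" by simp
    then show ?thesis using h[OF r] LIMSEQ_unique by blast
  qed
  with hc show ?thesis by (rule that)
qed

end

section \<open>Regularity of radial functions at the origin\<close>

lemma radial_flux_quotient_tendsto:
  fixes h w :: "real \<Rightarrow> real" and n :: nat
  assumes n: "1 \<le> n" and hc: "continuous_on {0..} h" and h0: "h 0 = 0"
    and dh: "\<And>r. 0 < r \<Longrightarrow> (h has_real_derivative (w r - (n - 1) * h r / r)) (at r)"
    and wc: "continuous_on {0..} w"
  shows "((\<lambda>r. h r / r) \<longlongrightarrow> w 0 / n) (at_right 0)"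
proof -
  have le: "at_right (0::real) \<le> at 0 within {0..}" by (rule at_le) auto
  have lim: "(k \<longlongrightarrow> k 0) (at_right 0)" if "continuous_on {0..} k" for k :: "real \<Rightarrow> real"
    using that by (intro tendsto_mono[OF le]) (auto simp: continuous_on_def)
  have ev: "\<forall>\<^sub>F r in at_right (0::real). 0 < r" by (rule eventually_at_right_less)
  \<comment> \<open>The derivative of \<open>r ^ (n - 1) * h r\<close> is
    \<open>r ^ (n - 1) * w r\<close>: the singular term cancels, and l'Hopital's rule leaves the
    quotient \<open>w r / n\<close>.\<close>
  have "((\<lambda>r. (r ^ (n - 1) * h r) / r ^ n) \<longlongrightarrow> w 0 / n) (at_right 0)"
  proof (rule lhopital_right_0)
    have "((\<lambda>r. r ^ (n - 1) * h r) \<longlongrightarrow> 0 ^ (n - 1) * h 0) (at_right 0)"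
      by (rule tendsto_mult[OF tendsto_power[OF tendsto_ident_at] lim[OF hc]])
    then show "((\<lambda>r. r ^ (n - 1) * h r) \<longlongrightarrow> 0) (at_right 0)" using h0 by simp
    have "((\<lambda>r::real. r ^ n) \<longlongrightarrow> 0 ^ n) (at_right 0)" by (intro tendsto_intros)
    then show "((\<lambda>r::real. r ^ n) \<longlongrightarrow> 0) (at_right 0)" using n by (simp add: power_0_left)
    show "\<forall>\<^sub>F r in at_right (0::real). r ^ n \<noteq> 0" using ev by eventually_elim auto
    show "\<forall>\<^sub>F r in at_right (0::real). real n * r ^ (n - 1) \<noteq> 0" using ev by eventually_elim (use n in auto)
    show "\<forall>\<^sub>F r in at_right 0. ((\<lambda>r. r ^ (n - 1) * h r) has_real_derivative r ^ (n - 1) * w r) (at r)"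
      using ev
    proof eventually_elim
      case (elim r)
      have "((\<lambda>r. r ^ m) has_real_derivative m * r ^ m / r) (at r)" for m
        using elim DERIV_pow[of m r] by (cases m) auto
      from DERIV_mult[OF this dh[OF elim]] show ?case
        by (rule DERIV_cong) (use elim in \<open>simp add: field_simps\<close>)
    qed
    show "\<forall>\<^sub>F r in at_right 0. ((\<lambda>r::real. r ^ n) has_real_derivative real n * r ^ (n - 1)) (at r)"
      using DERIV_pow[of n] by (simp add: always_eventually)
    have "((\<lambda>r. w r / n) \<longlongrightarrow> w 0 / n) (at_right 0)"
      using lim[OF wc] n by (intro tendsto_divide tendsto_const) auto
    then show "((\<lambda>r. (r ^ (n - 1) * w r) / (real n * r ^ (n - 1))) \<longlongrightarrow> w 0 / n) (at_right 0)"
      by (rule Lim_transform_eventually) (use ev in \<open>eventually_elim, auto\<close>)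
  qed
  moreover have "\<forall>\<^sub>F r in at_right 0. (r ^ (n - 1) * h r) / r ^ n = h r / r"
    using ev
  proof eventually_elim
    case (elim r)
    have "r ^ n = r ^ (n - 1) * r" using n by (cases n) auto
    then show ?case using elim by simp
  qed
  ultimately show ?thesis by (rule Lim_transform_eventually)
qed

text \<open>\<open>j\<close> stands for r times the derivative of \<open>\<kappa>\<close>. The
  rank-one part of \<open>D\<close> has norm at most \<open>\<bar>j (norm x)\<bar> * norm b\<close>,
  so \<open>j 0 = 0\<close> makes it continuous at the origin, where the derivative is
  multiplication by \<open>\<kappa> 0\<close>.\<close>

lemma radial_field_regular:
  fixes \<kappa> j :: "real \<Rightarrow> real" and V :: "'a::euclidean_space \<Rightarrow> 'a"
  assumes kc: "continuous_on {0..} \<kappa>" and jc: "continuous_on {0..} j" and j0: "j 0 = 0"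
    and dk: "\<And>r. 0 < r \<Longrightarrow> (\<kappa> has_real_derivative j r / r) (at r)"
    and V: "\<And>x. V x = \<kappa> (norm x) *\<^sub>R x"
  defines "D \<equiv> \<lambda>x b. \<kappa> (norm x) *\<^sub>R b + (j (norm x) * ((x \<bullet> b) / (norm x)\<^sup>2)) *\<^sub>R x"
  shows "(V has_derivative D x) (at x)" and "continuous_on UNIV (\<lambda>x. D x b)"
    and "divergence V x = DIM('a) * \<kappa> (norm x) + j (norm x)"
proof -
  have Veq: "V = (\<lambda>x. \<kappa> (norm x) *\<^sub>R x)" using V by auto
  have cnorm: "continuous_on UNIV (\<lambda>x::'a. k (norm x))" if "continuous_on {0..} k" for k :: "real \<Rightarrow> real"
    by (rule continuous_on_compose2[OF that]) (auto intro!: continuous_intros)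
  show dV: "(V has_derivative D x) (at x)"
  proof (cases "x = 0")
    case False
    have "(norm has_derivative (\<lambda>b. (x \<bullet> b) / norm x)) (at x)"
      using has_derivative_norm_powr[OF False, of 1] False
      by (auto simp: powr_minus_divide elim!: has_derivative_eq_rhs)
    from has_derivative_compose[OF this dk[unfolded has_field_derivative_def]]
    have "((\<lambda>x. \<kappa> (norm x)) has_derivative (\<lambda>b. j (norm x) / norm x * ((x \<bullet> b) / norm x))) (at x)"
      using False by simp
    from has_derivative_scaleR[OF this has_derivative_ident]
    show ?thesis unfolding Veq
      by (rule has_derivative_eq_rhs) (auto simp: D_def power2_eq_square)
  next
    case True
    have "isCont (\<lambda>x::'a. \<kappa> (norm x)) 0"
      using cnorm[OF kc] by (simp add: continuous_on_eq_continuous_at)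
    then have "((\<lambda>b::'a. \<kappa> (norm b) - \<kappa> 0) \<longlongrightarrow> 0) (at 0)"
      by (simp add: isCont_def LIM_zero)
    then have "((\<lambda>b::'a. norm (\<kappa> (norm b) - \<kappa> 0)) \<longlongrightarrow> 0) (at 0)"
      by (rule tendsto_norm_zero)
    then have "((\<lambda>b::'a. norm (V (0 + b) - V 0 - \<kappa> 0 *\<^sub>R b) / norm b) \<longlongrightarrow> 0) (at 0)"
      by (rule Lim_transform_eventually)
        (auto simp: eventually_at_filter V scaleR_diff_left[symmetric])
    then have "(V has_derivative (\<lambda>b. \<kappa> 0 *\<^sub>R b)) (at 0)"
      unfolding has_derivative_at by (auto intro: bounded_linear_scaleR_right)
    then show ?thesis using True by (simp add: D_def)
  qed
  show "continuous_on UNIV (\<lambda>x. D x b)"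
    unfolding D_def
  proof (rule continuous_on_add[OF continuous_on_scaleR[OF cnorm[OF kc] continuous_on_const]])
    have "isCont (\<lambda>x. (j (norm x) * ((x \<bullet> b) / (norm x)\<^sup>2)) *\<^sub>R x) x" for x :: 'a
    proof (cases "x = 0")
      case False
      have "isCont (\<lambda>x::'a. j (norm x)) x"
        using cnorm[OF jc] by (simp add: continuous_on_eq_continuous_at)
      then show ?thesis using False by (intro continuous_intros) auto
    next
      case True
      have "isCont (\<lambda>x::'a. j (norm x)) 0"
        using cnorm[OF jc] by (simp add: continuous_on_eq_continuous_at)
      then have "((\<lambda>x::'a. j (norm x)) \<longlongrightarrow> 0) (at 0)" by (simp add: isCont_def j0)
      then have "((\<lambda>x. (j (norm x) * ((x \<bullet> b) / (norm x)\<^sup>2)) *\<^sub>R x) \<longlongrightarrow> 0) (at (0::'a))"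
      proof (rule tendsto_0_le)
        show "\<forall>\<^sub>F x::'a in at 0. norm ((j (norm x) * ((x \<bullet> b) / (norm x)\<^sup>2)) *\<^sub>R x) \<le> norm (j (norm x)) * norm b"
        proof (rule eventually_at_filter[THEN iffD2], rule always_eventually, intro allI impI)
          fix x :: 'a assume x: "x \<noteq> 0"
          have "norm ((j (norm x) * ((x \<bullet> b) / (norm x)\<^sup>2)) *\<^sub>R x) = \<bar>j (norm x)\<bar> * (\<bar>x \<bullet> b\<bar> / norm x)"
            using x by (simp add: abs_mult power2_eq_square)
          also have "\<dots> \<le> \<bar>j (norm x)\<bar> * norm b"
            using x Cauchy_Schwarz_ineq2[of x b] by (intro mult_left_mono) (auto simp: field_simps)
          finally show "norm ((j (norm x) * ((x \<bullet> b) / (norm x)\<^sup>2)) *\<^sub>R x) \<le> norm (j (norm x)) * norm b"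
            by simp
        qed
      qed
      then show ?thesis using True by (simp add: isCont_def)
    qed
    then show "continuous_on UNIV (\<lambda>x. (j (norm x) * ((x \<bullet> b) / (norm x)\<^sup>2)) *\<^sub>R x)"
      by (simp add: continuous_at_imp_continuous_on)
  qed
  have "divergence V x = (\<Sum>b\<in>Basis. D x b \<bullet> b)" by (rule divergence_eqI[OF dV])
  also have "\<dots> = (\<Sum>b\<in>Basis. \<kappa> (norm x) + j (norm x) / (norm x)\<^sup>2 * ((x \<bullet> b) * (x \<bullet> b)))"
    by (intro sum.cong refl) (simp add: D_def inner_add_left)
  also have "\<dots> = DIM('a) * \<kappa> (norm x) + j (norm x) / (norm x)\<^sup>2 * (x \<bullet> x)"
    by (simp only: sum.distrib sum_distrib_left[symmetric] euclidean_inner[of x x] sum_constant)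
  also have "\<dots> = DIM('a) * \<kappa> (norm x) + j (norm x)"
    using j0 by (cases "x = 0") (auto simp: power2_norm_eq_inner)
  finally show "divergence V x = DIM('a) * \<kappa> (norm x) + j (norm x)" .
qed

context increasing_nonlinearities
begin

text \<open>Since (p - 1)(q - 1) = 1, the flux of \<open>u\<close> is the radial field of length
  \<open>h (norm x)\<close>, that is \<open>\<kappa> (norm x) *\<^sub>R x\<close> with
  \<open>\<kappa>\<close> = h / r. Regularity thus reduces to continuity of \<open>\<kappa>\<close>
  and of r times its derivative up to the origin.\<close>

lemma radial_plap_regular:
  fixes \<phi> h w :: "real \<Rightarrow> real"
  assumes hc: "continuous_on {0..} h" and h0: "h 0 = 0" and h_pos: "\<And>r. 0 < r \<Longrightarrow> 0 < h r"
    and dphi: "\<And>r. 0 \<le> r \<Longrightarrow> (\<phi> has_real_derivative h r powr (q - 1)) (at r within {0..})"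
    and dh: "\<And>r. 0 < r \<Longrightarrow> (h has_real_derivative (w r - (DIM('a) - 1) * h r / r)) (at r)"
    and wc: "continuous_on {0..} w"
  defines "u \<equiv> \<lambda>x::'a::euclidean_space. \<phi> (norm x)"
  shows "plap_regular p u" and "p_laplacian p u x = w (norm x)"
    and "norm (grad u x) = h (norm x) powr (q - 1)"
proof -
  let ?n = "DIM('a)"
  have n: "1 \<le> ?n" by (simp add: Suc_le_eq)
  let ?P = "\<lambda>r. h r powr (q - 1)"
  have h_nonneg: "0 \<le> h r" if "0 \<le> r" for r using that h0 h_pos[of r] by (cases "r = 0") auto
  have Pc: "continuous_on {0..} ?P"
    by (rule continuous_on_powr'[OF hc continuous_on_const]) (use h_nonneg q_gt_1 in auto)
  \<comment> \<open>The value at 0 is the limit of \<open>h r / r\<close> given by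
    \<open>radial_flux_quotient_tendsto\<close>.\<close>
  define \<kappa> where "\<kappa> r = (if r = 0 then w 0 / ?n else h r / r)" for r
  \<comment> \<open>By the equation for \<open>h\<close>, r (h / r)' = h' - h / r equals this
    expression, so the divergence of the flux is \<open>w\<close>.\<close>
  define j where "j r = w r - ?n * \<kappa> r" for r
  have lim0: "((\<lambda>r. h r / r) \<longlongrightarrow> w 0 / ?n) (at_right 0)"
    by (rule radial_flux_quotient_tendsto[OF n hc h0 dh wc]) (use n in \<open>auto simp: of_nat_diff\<close>)
  have kc: "continuous_on {0..} \<kappa>"
    unfolding continuous_on_def
  proof
    fix r :: real assume r: "r \<in> {0..}"
    show "(\<kappa> \<longlongrightarrow> \<kappa> r) (at r within {0..})"
    proof (cases "r = 0")
      case True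
      have "(\<kappa> \<longlongrightarrow> \<kappa> 0) (at_right 0)"
        using lim0 by (rule Lim_transform_eventually[THEN tendsto_eq_rhs])
          (auto simp: \<kappa>_def eventually_at_filter)
      moreover have "at (0::real) within {0..} = at_right 0"
        unfolding at_within_def
        by (rule arg_cong[of "{0..} - {0}" "{0<..} - {0}" "\<lambda>S. inf (nhds 0) (principal S)"]) auto
      ultimately show ?thesis using True by simp
    next
      case False
      then have r: "0 < r" using r by simp
      have "isCont h r" using dh[OF r] by (rule DERIV_isCont)
      then have "((\<lambda>r. h r / r) \<longlongrightarrow> h r / r) (at r)"
        using r by (intro tendsto_divide tendsto_ident_at) (auto simp: isCont_def)
      moreover have "\<forall>\<^sub>F s in at r. h s / s = \<kappa> s"
      proof -
        have "\<forall>\<^sub>F s in at r. s \<in> {0<..}" by (rule eventually_at_in_open') (use r in auto)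
        then show ?thesis by eventually_elim (simp add: \<kappa>_def)
      qed
      ultimately have "(\<kappa> \<longlongrightarrow> h r / r) (at r)" by (rule Lim_transform_eventually)
      then show ?thesis using r by (auto simp: \<kappa>_def intro: tendsto_within_subset)
    qed
  qed
  have jc: "continuous_on {0..} j" unfolding j_def by (intro continuous_intros wc kc)
  have j0: "j 0 = 0" using n by (simp add: j_def \<kappa>_def)
  have dk: "(\<kappa> has_real_derivative j r / r) (at r)" if r: "0 < r" for r
  proof -
    have "((\<lambda>r. h r / r) has_real_derivative
        ((w r - (?n - 1) * h r / r) * r - h r * 1) / (r * r)) (at r)"
      by (rule DERIV_divide[OF dh[OF r] DERIV_ident]) (use r in auto)
    then have "((\<lambda>r. h r / r) has_real_derivative j r / r) (at r)"
      by (rule DERIV_cong) (use r n in \<open>simp add: j_def \<kappa>_def field_simps of_nat_diff\<close>)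
    then show ?thesis
      by (rule has_field_derivative_transform_within_open[of _ _ _ "{0<..}"])
        (use r in \<open>auto simp: \<kappa>_def\<close>)
  qed
  define G where "G x = (if x = 0 then 0 else (?P (norm x) / norm x) *\<^sub>R x)" for x :: 'a
  have du: "(u has_derivative (\<lambda>b. G x \<bullet> b)) (at x)" for x
  proof (cases "x = 0")
    case False
    have r: "0 < norm x" using False by simp
    have 1: "(\<phi> has_real_derivative ?P (norm x)) (at (norm x))"
      using dphi[of "norm x"] r at_within_open_subset[of "norm x" "{0<..}" "{0..}"]
      by (simp add: subset_eq)
    have 2: "(norm has_derivative (\<lambda>b. (x \<bullet> b) / norm x)) (at x)"
      using has_derivative_norm_powr[OF False, of 1] False
      by (auto simp: powr_minus_divide elim!: has_derivative_eq_rhs)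
    have "(u has_derivative (\<lambda>b. ?P (norm x) * ((x \<bullet> b) / norm x))) (at x)"
      unfolding u_def by (rule has_derivative_compose[OF 2 1[unfolded has_field_derivative_def]])
    then show ?thesis
      by (rule has_derivative_eq_rhs) (use False in \<open>auto simp: G_def\<close>)
  next
    case True
    have "(\<phi> has_real_derivative 0) (at 0 within {0..})" using dphi[of 0] h0 by simp
    then have "((\<lambda>r. (\<phi> r - \<phi> 0) / (r - 0)) \<longlongrightarrow> 0) (at 0 within {0..})"
      by (simp add: has_field_derivative_iff)
    moreover have "filterlim (norm :: 'a \<Rightarrow> real) (at 0 within {0..}) (at 0)"
      by (auto simp: filterlim_at eventually_at_filter intro!: tendsto_eq_intros)
    ultimately have "((\<lambda>b::'a. (\<phi> (norm b) - \<phi> 0) / (norm b - 0)) \<longlongrightarrow> 0) (at 0)"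
      by (rule filterlim_compose)
    then have "((\<lambda>b::'a. norm ((\<phi> (norm b) - \<phi> 0) / (norm b - 0))) \<longlongrightarrow> 0) (at 0)"
      by (rule tendsto_norm_zero)
    then have "(u has_derivative (\<lambda>b. 0)) (at 0)"
      unfolding has_derivative_at u_def by simp
    then show ?thesis using True by (simp add: G_def)
  qed
  have grad: "grad u x = G x" for x by (rule grad_eqI[OF du])
  show normG: "norm (grad u x) = ?P (norm x)" for x
    by (auto simp: grad G_def h0)
  have Gc: "continuous_on UNIV G"
  proof (rule continuous_at_imp_continuous_on, rule ballI)
    fix x :: 'a
    have P: "isCont (\<lambda>x::'a. ?P (norm x)) x"
    proof -
      have "continuous_on UNIV (\<lambda>x::'a. ?P (norm x))"
        by (rule continuous_on_compose2[OF Pc]) (auto intro!: continuous_intros)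
      then show ?thesis by (simp add: continuous_on_eq_continuous_at)
    qed
    show "isCont G x"
    proof (cases "x = 0")
      case False
      have 1: "isCont (\<lambda>x. (?P (norm x) / norm x) *\<^sub>R x) x"
        using False by (intro continuous_scaleR continuous_divide P continuous_norm continuous_ident) auto
      have 2: "\<forall>\<^sub>F y in nhds x. (?P (norm y) / norm y) *\<^sub>R y = G y"
        using False by (auto simp: eventually_nhds G_def intro!: exI[of _ "-{0}"])
      show ?thesis by (rule isCont_cong[THEN iffD1, OF 2 1])
    next
      case True
      have "((\<lambda>x::'a. ?P (norm x)) \<longlongrightarrow> 0) (at 0)"
        using P True h0 by (simp add: isCont_def)
      then have "(G \<longlongrightarrow> 0) (at 0)"
        by (rule tendsto_0_le[where K = 1]) (auto simp: G_def)
      then show ?thesis using True by (simp add: isCont_def G_def)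
    qed
  qed
  have flux: "plap_flux p u x = \<kappa> (norm x) *\<^sub>R x" for x
  proof (cases "x = 0")
    case False
    let ?r = "norm x"
    have hp: "0 < h ?r" using False h_pos by simp
    have e: "(q - 1) * (p - 2) + (q - 1) = 1" using conjugate by (simp add: algebra_simps)
    have "?P ?r powr (p - 2) * ?P ?r = h ?r powr ((q - 1) * (p - 2) + (q - 1))"
      by (simp add: powr_powr powr_add)
    then have "?P ?r powr (p - 2) * ?P ?r = h ?r" unfolding e using hp by simp
    then show ?thesis
      using False unfolding plap_flux_def normG by (simp add: grad G_def \<kappa>_def)
  qed (simp add: plap_flux_def grad G_def)
  note R = radial_field_regular[OF kc jc j0 dk flux]
  show "plap_regular p u"
    unfolding plap_regular_def
  proof (intro conjI allI ballI)
    show "u differentiable (at x)" for x using du[of x] by (auto simp: differentiable_def)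
    show "continuous_on UNIV (grad u)" using Gc grad by (simp add: ext)
    show "plap_flux p u differentiable (at x)" for x using R(1)[of x] by (auto simp: differentiable_def)
    fix b :: 'a
    show "continuous_on UNIV (\<lambda>x. frechet_derivative (plap_flux p u) (at x) b)"
      using R(2)[of b] by (subst frechet_derivative_at[OF R(1), symmetric])
  qed
  show "p_laplacian p u x = w (norm x)"
    using R(3)[of x] by (simp add: p_laplacian_def j_def)
qed

text \<open>\<open>v\<close> stands for the truncated \<open>f(min \<phi> M)\<close>; the equation for \<open>h\<close> is only an inequality because
  the nonpositive term \<open>-(n - 1) h / r\<close> is dropped.\<close>
definition radial_flow :: "(real \<Rightarrow> real) \<Rightarrow> (real \<Rightarrow> real) \<Rightarrow> (real \<Rightarrow> real) \<Rightarrow> bool" where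
  "radial_flow \<phi> h v \<longleftrightarrow> continuous_on {0..} h \<and> h 0 = 0 \<and> (\<forall>r>0. 0 < h r) \<and> \<phi> 0 = 1
     \<and> (\<forall>r\<ge>0. (\<phi> has_real_derivative h r powr (q - 1)) (at r within {0..}))
     \<and> mono_on {0..} v \<and> 0 \<le> v 0 \<and> (\<forall>r\<ge>0. v r \<le> f (\<phi> r))
     \<and> (\<forall>r>0. \<exists>d \<le> v r - g (h r powr (q - 1)). (h has_real_derivative d) (at r))"

section \<open>A priori bounds along radial flows\<close>

context
  fixes \<phi> h v assumes flow: "radial_flow \<phi> h v"
begin

lemma flow_props:
  shows hc: "continuous_on {0..} h" and h0: "h 0 = 0" and h_pos: "\<And>r. 0 < r \<Longrightarrow> 0 < h r"
    and phi0: "\<phi> 0 = 1"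
    and dphi: "\<And>r. 0 \<le> r \<Longrightarrow> (\<phi> has_real_derivative h r powr (q - 1)) (at r within {0..})"
    and v_mono: "mono_on {0..} v" and v0: "0 \<le> v 0" and v_le: "\<And>r. 0 \<le> r \<Longrightarrow> v r \<le> f (\<phi> r)"
    and dh: "\<And>r. 0 < r \<Longrightarrow> \<exists>d \<le> v r - g (h r powr (q - 1)). (h has_real_derivative d) (at r)"
  using flow unfolding radial_flow_def by auto

lemma h_nonneg: "0 \<le> r \<Longrightarrow> 0 \<le> h r"
  using h_pos[of r] h0 by (cases "r = 0") auto

lemma phi_cont: "continuous_on {0..} \<phi>"
  unfolding continuous_on_eq_continuous_within
  using dphi by (auto intro: DERIV_continuous)

lemma dphi_at: "0 < r \<Longrightarrow> (\<phi> has_real_derivative h r powr (q - 1)) (at r)"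
  using dphi[of r] at_within_open_subset[of r "{0<..}" "{0..}"] by (simp add: subset_eq)

lemma phi_gt_1: "0 < r \<Longrightarrow> 1 < \<phi> r"
  using deriv_pos_imp_less_atLeast[OF phi_cont dphi_at, of 0 r] h_pos phi0
  by (auto simp: less_imp_neq[symmetric])

lemma phi_ge_1: "0 \<le> r \<Longrightarrow> 1 \<le> \<phi> r"
  using phi_gt_1[of r] phi0 by (cases "r = 0") auto

text \<open>Multiplying h' \<le> f(\<phi>) by q h^(q-1) = q \<phi>' gives (h^q)' \<le> (q
  F(\<phi>))'. Here h^q is the p-th power of \<phi>', and the initial energy -q F(1) is
  nonpositive.\<close>

lemma energy_bound:
  assumes r: "0 \<le> r"
  shows "h r powr (q - 1) \<le> (q * F (\<phi> r)) powr (1 / p)"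
proof (cases "r = 0")
  case True
  then show ?thesis by (simp add: h0)
next
  case False
  then have r: "0 < r" using r by simp
  define E where "E r = h r powr q - q * F (\<phi> r)" for r
  have "E r \<le> E 0"
  proof (rule DERIV_nonpos_imp_decreasing_open[of 0 r E, OF less_imp_le[OF r]])
    fix x assume x: "0 < x" "x < r"
    obtain d where d: "d \<le> v x - g (h x powr (q - 1))" "(h has_real_derivative d) (at x)"
      using dh[OF x(1)] by blast
    have hx: "0 < h x" using h_pos x by simp
    have "((\<lambda>x. h x powr q) has_real_derivative (q * h x powr (q - 1) * d)) (at x)"
      using DERIV_chain2[OF has_real_derivative_powr[OF hx] d(2)] by simp
    moreover have "((\<lambda>x. F (\<phi> x)) has_real_derivative (f (\<phi> x) * h x powr (q - 1))) (at x)"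
      using DERIV_chain2[OF F_deriv dphi_at[OF x(1)]] phi_gt_1[OF x(1)] by simp
    ultimately have "(E has_real_derivative (q * h x powr (q - 1) * d - q * (f (\<phi> x) * h x powr (q - 1)))) (at x)"
      unfolding E_def by (intro DERIV_diff DERIV_cmult)
    moreover have "d \<le> f (\<phi> x)"
      using d(1) v_le[of x] g_nonneg[of "h x powr (q - 1)"] x by simp
    then have "(q * h x powr (q - 1)) * d \<le> (q * h x powr (q - 1)) * f (\<phi> x)"
      using q_gt_1 by (intro mult_left_mono) auto
    then have "q * h x powr (q - 1) * d - q * (f (\<phi> x) * h x powr (q - 1)) \<le> 0"
      by (simp add: mult_ac)
    ultimately show "\<exists>y. (E has_real_derivative y) (at x) \<and> y \<le> 0" by blast
  next
    have 1: "continuous_on {0..r} (\<lambda>r. h r powr q)"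
      by (rule continuous_on_powr'[OF continuous_on_subset[OF hc] continuous_on_const])
        (use h_nonneg q_gt_1 in auto)
    have "continuous_on {0..r} (\<lambda>r. F (\<phi> r))"
    proof (rule continuous_on_compose2[OF F_cont continuous_on_subset[OF phi_cont]])
      show "\<phi> ` {0..r} \<subseteq> {0..}" using phi_ge_1 by force
    qed auto
    then show "continuous_on {0..r} E"
      unfolding E_def by (intro continuous_on_diff 1 continuous_on_mult_left)
  qed
  also have "E 0 \<le> 0" using q_gt_1 F_nonneg[of 1] by (simp add: E_def h0 phi0)
  finally have "(h r powr q) powr (1 / p) \<le> (q * F (\<phi> r)) powr (1 / p)"
    using p by (intro powr_mono2) (auto simp: E_def)
  moreover have "q / p = q - 1" using p by (simp add: q field_simps)
  ultimately show ?thesis by (simp add: powr_powr)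
qed

text \<open>The stronger barrier g(\<phi>') \<le> v is preserved: where it fails, \<open>h\<close>
  cannot increase, while \<open>v\<close> never decreases.\<close>

lemma gradient_bound:
  assumes r: "0 \<le> r"
  shows "g (h r powr (q - 1)) \<le> f (\<phi> r)"
proof -
  let ?P = "\<lambda>r. h r powr (q - 1)"
  have Pc: "continuous_on {0..} ?P"
    by (rule continuous_on_powr'[OF hc continuous_on_const]) (use h_nonneg q_gt_1 in auto)
  have gPc: "continuous_on {0..} (\<lambda>r. g (?P r))"
    by (rule continuous_on_compose2[OF g_cont Pc]) auto
  have "g (?P r) \<le> v r"
  proof (rule ccontr)
    assume gt: "\<not> g (?P r) \<le> v r"
    \<comment> \<open>Freezing the level at \<open>v r\<close> makes \<open>Z\<close> closed by
      continuity of \<open>g\<close> and \<open>h\<close>; \<open>v\<close> enters only through its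
      monotonicity. Beyond the last point of \<open>Z\<close> the flow has g(\<phi>') > v r \<ge> v,
      so \<open>h\<close> does not increase up to \<open>r\<close>.\<close>
    define Z where "Z = {s \<in> {0..r}. g (?P s) \<le> v r}"
    have vr: "v s \<le> v r" if "0 \<le> s" "s \<le> r" for s
      using mono_onD[OF v_mono, of s r] that by auto
    have "closed Z"
    proof -
      have "closed {s \<in> {0..r}. g (?P s) \<le> v r}"
        by (intro continuous_on_closed_Collect_le continuous_on_const)
          (auto intro: continuous_on_subset[OF gPc])
      then show ?thesis by (simp add: Z_def)
    qed
    moreover have "bounded Z" by (rule bounded_subset[of "{0..r}"]) (auto simp: Z_def)
    ultimately have "compact Z" by (simp add: compact_eq_bounded_closed)
    moreover have "0 \<in> Z" using r v0 vr[of 0] by (auto simp: Z_def h0 g0)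
    ultimately obtain s where s: "s \<in> Z" "\<And>t. t \<in> Z \<Longrightarrow> t \<le> s"
      using compact_attains_sup[of Z] by auto
    have s_le: "0 \<le> s" "s \<le> r" "g (?P s) \<le> v r" using s(1) by (auto simp: Z_def)
    have "s \<noteq> r" using s_le gt by auto
    then have sr: "s < r" using s_le by simp
    have "h r \<le> h s"
    proof (rule DERIV_nonpos_imp_decreasing_open[OF less_imp_le[OF sr]])
      fix x assume x: "s < x" "x < r"
      obtain d where d: "d \<le> v x - g (?P x)" "(h has_real_derivative d) (at x)"
        using dh[of x] x s_le by auto
      have "x \<notin> Z" using s(2)[of x] x by auto
      then have "v r < g (?P x)" using x s_le by (auto simp: Z_def)
      then have "d \<le> 0" using d(1) vr[of x] x s_le by simp
      then show "\<exists>y. (h has_real_derivative y) (at x) \<and> y \<le> 0" using d(2) by blast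
    qed (use s_le in \<open>auto intro: continuous_on_subset[OF hc]\<close>)
    then have "g (?P r) \<le> g (?P s)"
      using h_nonneg[OF r] q_gt_1 by (intro g_le powr_mono2) auto
    then show False using s_le gt by simp
  qed
  then show ?thesis using v_le[OF r] by simp
qed

end

text \<open>\<open>\<Phi>\<close> is the time that M' = K(M) needs to climb from 1 to a given level;
  its unboundedness makes \<open>M\<close> global. Cutting off \<phi> at \<open>M\<close> and
  \<open>h\<close> to the interval from 0 to \<open>U\<close> bounds the right-hand side for every
  continuous \<open>h\<close>. Positivity, h \<le> U and \<phi> \<le> M then show that the cut-offs
  are inactive on the solution.\<close>

lemma radial_solution_exists:
  fixes K :: "real \<Rightarrow> real"
  assumes Kc: "continuous_on {1..} K" and Kpos: "\<And>s. 1 \<le> s \<Longrightarrow> 0 < K s"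
    and unb: "\<And>B. \<exists>s\<ge>1. B \<le> integral {1..s} (\<lambda>s. 1 / K s)"
    and apriori: "\<And>\<phi> h v r. \<lbrakk>radial_flow \<phi> h v; 0 \<le> r\<rbrakk> \<Longrightarrow> h r powr (q - 1) \<le> K (\<phi> r)"
  shows "\<exists>u :: 'a::euclidean_space \<Rightarrow> real. plap_solution p f g u \<and> (\<forall>x. 0 < u x)"
proof -
  define N where "N = DIM('a) - 1"
  define \<Phi> where "\<Phi> s = integral {1..s} (\<lambda>s. 1 / K s)" for s
  have rc: "continuous_on {1..} (\<lambda>s. 1 / K s)"
    by (rule continuous_on_divide[OF continuous_on_const Kc]) (use Kpos in force)
  have Phi_c: "continuous_on {1..} \<Phi>" unfolding \<Phi>_def by (rule continuous_on_integral_atLeast[OF rc])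
  have Phi_d: "(\<Phi> has_real_derivative 1 / K s) (at s)" if "1 < s" for s
    unfolding \<Phi>_def by (rule has_real_derivative_integral_atLeast[OF rc that])
  have Phi_less: "\<Phi> s < \<Phi> t" if "1 \<le> s" "s < t" for s t
    by (rule deriv_pos_imp_less_atLeast[OF Phi_c Phi_d]) (use that Kpos in auto)
  have Phi1: "\<Phi> 1 = 0" by (simp add: \<Phi>_def)

  \<comment> \<open>\<open>inv0\<close> inverts on the half-line from 0, whereas
    \<open>\<Phi>\<close> lives on the half-line from 1.\<close>
  define m where "m t = \<Phi> (1 + t)" for t
  have mc: "continuous_on {0..} m" unfolding m_def
    by (rule continuous_on_compose2[OF Phi_c]) (auto intro!: continuous_intros)
  have m_mono: "strict_mono_on {0..} m"
    by (rule strict_mono_onI) (auto simp: m_def intro: Phi_less)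
  have m_im: "m ` {0..} = {0..}"
  proof (rule image_atLeast0_unbounded[OF mc m_mono])
    show "m 0 = 0" by (simp add: m_def Phi1)
    fix y obtain s where "1 \<le> s" "y \<le> \<Phi> s" using unb[of y] by (auto simp: \<Phi>_def)
    then show "\<exists>s\<ge>0. y \<le> m s" by (intro exI[of _ "s - 1"]) (auto simp: m_def)
  qed
  define M where "M r = 1 + inv0 m r" for r
  have M: "\<Phi> (M r) = r" "1 \<le> M r" if "0 \<le> r" for r
  proof -
    have "r \<in> m ` {0..}" using that by (simp add: m_im)
    then obtain t where "0 \<le> t" "r = m t" by auto
    then show "\<Phi> (M r) = r" "1 \<le> M r"
      using inv0_strict_mono[OF m_mono] by (auto simp: M_def m_def)
  qed
  have Mc: "continuous_on {0..} M"
    unfolding M_def using continuous_on_inv0[OF m_mono] by (auto simp: m_im intro!: continuous_intros)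
  have M_mono: "M r \<le> M s" if "0 \<le> r" "r \<le> s" for r s
  proof (rule ccontr)
    assume "\<not> M r \<le> M s"
    then have "\<Phi> (M s) < \<Phi> (M r)" using M that by (intro Phi_less) auto
    then show False using M that by auto
  qed

  \<comment> \<open>Discarding \<open>g\<close> in (r^N h)' = r^N W h and using that f(M) is
    nondecreasing bounds \<open>h r\<close> by \<open>r * f (M r)\<close>.\<close>
  define U where "U r = r * f (M r)" for r
  have fM_mono: "f (M r) \<le> f (M s)" if "0 \<le> r" "r \<le> s" for r s
    using M_mono[OF that] M(2)[OF that(1)] by (intro f_le) auto
  have fM_pos: "0 < f (M r)" if "0 \<le> r" for r using M(2)[OF that] by (intro f_pos) auto
  have U_nonneg: "0 \<le> U r" if "0 \<le> r" for r using fM_pos[OF that] that by (simp add: U_def)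
  have U_mono: "U r \<le> U s" if "0 \<le> r" "r \<le> s" for r s
    unfolding U_def using that fM_mono[OF that] fM_pos[of r] by (intro mult_mono) auto
  have fMc: "continuous_on {0..} (\<lambda>r. f (M r))"
    by (rule continuous_on_compose2[OF f_cont Mc]) (use M in force)
  have Uc: "continuous_on {0..} U" unfolding U_def by (intro continuous_intros fMc)

  \<comment> \<open>A clamped surrogate for \<phi>', bounded whatever \<open>h\<close> is; the sign
    of an approximate solution is not under control.\<close>
  define c where "c h r = max 0 (min (h r) (U r)) powr (q - 1)" for h :: "real \<Rightarrow> real" and r
  define \<phi> where "\<phi> h r = 1 + integral {0..r} (c h)" for h r
  define W where "W h r = f (min (\<phi> h r) (M r)) - g (c h r)" for h r
  define B where "B r = f (M r) + g (U r powr (q - 1))" for r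

  have c_cont: "continuous_on {0..} (c h)" if "continuous_on {0..} h" for h
    unfolding c_def
    by (rule continuous_on_powr') (use that Uc q_gt_1 in \<open>auto intro!: continuous_intros\<close>)
  have c_nonneg: "0 \<le> c h r" for h r by (simp add: c_def)
  have c_le: "c h r \<le> U r powr (q - 1)" if "0 \<le> r" for h r
    unfolding c_def using U_nonneg[OF that] q_gt_1 by (intro powr_mono2) auto
  have c_int: "c h integrable_on {0..r}" if "continuous_on {0..} h" for h r
    by (intro integrable_continuous_interval continuous_on_subset[OF c_cont[OF that]]) auto
  have phi_c: "continuous_on {0..} (\<phi> h)" if "continuous_on {0..} h" for h
    unfolding \<phi>_def by (intro continuous_on_add continuous_on_const continuous_on_integral_atLeast c_cont that)
  have phi_ge: "1 \<le> \<phi> h r" if "continuous_on {0..} h" for h r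
    unfolding \<phi>_def using integral_nonneg[OF c_int[OF that]] c_nonneg by simp
  have min_ge: "1 \<le> min (\<phi> h r) (M r)" if "continuous_on {0..} h" "0 \<le> r" for h r
    using phi_ge[OF that(1)] M(2)[OF that(2)] by simp
  have fmin_pos: "0 < f (min (\<phi> h r) (M r))" if "continuous_on {0..} h" "0 \<le> r" for h r
    using min_ge[OF that] by (intro f_pos) auto
  have fmin_le: "f (min (\<phi> h r) (M r)) \<le> f (M r)" if "continuous_on {0..} h" "0 \<le> r" for h r
    using min_ge[OF that] by (intro f_le) auto

  interpret radial_volterra N W B
  proof
    fix h1 h2 :: "real \<Rightarrow> real" and r :: real
    assume r: "0 \<le> r" and eq: "\<And>s. \<lbrakk>0 \<le> s; s \<le> r\<rbrakk> \<Longrightarrow> h1 s = h2 s"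
    have "c h1 s = c h2 s" if "0 \<le> s" "s \<le> r" for s using eq[OF that] by (simp add: c_def)
    then have "c h1 r = c h2 r" "integral {0..r} (c h1) = integral {0..r} (c h2)"
      using r by (auto intro!: integral_cong)
    then show "W h1 r = W h2 r" by (simp add: W_def \<phi>_def)
  next
    fix h :: "real \<Rightarrow> real" assume h: "continuous_on {0..} h"
    have "continuous_on {0..} (\<lambda>r. f (min (\<phi> h r) (M r)))"
    proof (rule continuous_on_compose2[OF f_cont continuous_on_min[OF phi_c[OF h] Mc]])
      show "(\<lambda>r. min (\<phi> h r) (M r)) ` {0..} \<subseteq> {0..}" using min_ge[OF h] by force
    qed
    moreover have "continuous_on {0..} (\<lambda>r. g (c h r))"
      by (rule continuous_on_compose2[OF g_cont c_cont[OF h]]) (auto simp: c_nonneg)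
    ultimately show "continuous_on {0..} (W h)" unfolding W_def by (rule continuous_on_diff)
  next
    fix h :: "real \<Rightarrow> real" and r :: real assume h: "continuous_on {0..} h" and r: "0 \<le> r"
    have "g (c h r) \<le> g (U r powr (q - 1))" using c_le[OF r] c_nonneg by (intro g_le) auto
    then show "\<bar>W h r\<bar> \<le> B r"
      using fmin_pos[OF h r] fmin_le[OF h r] g_nonneg[OF c_nonneg[of h r]]
      unfolding W_def B_def by linarith
  next
    fix r s :: real assume rs: "0 \<le> r" "r \<le> s"
    show "B r \<le> B s" unfolding B_def
      using rs U_nonneg U_mono q_gt_1 by (intro add_mono fM_mono g_le powr_mono2) auto
  next
    fix H :: "nat \<Rightarrow> real \<Rightarrow> real" and h :: "real \<Rightarrow> real" and r :: real
    assume r: "0 \<le> r" and Hc: "\<And>k. continuous_on {0..} (H k)" and hc: "continuous_on {0..} h"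
      and lim: "\<And>s. 0 \<le> s \<Longrightarrow> (\<lambda>k. H k s) \<longlonglongrightarrow> h s"
    have c_lim: "(\<lambda>k. c (H k) s) \<longlonglongrightarrow> c h s" if "0 \<le> s" for s
      unfolding c_def
      by (intro tendsto_powr2 tendsto_max tendsto_min tendsto_const lim that) (use q_gt_1 in auto)
    have "(\<lambda>k. integral {0..r} (c (H k))) \<longlonglongrightarrow> integral {0..r} (c h)"
    proof (rule dominated_convergence(2)[where h = "\<lambda>_. U r powr (q - 1)"])
      show "norm (c (H k) s) \<le> U r powr (q - 1)" if s: "s \<in> {0..r}" for k s
      proof -
        have "c (H k) s \<le> U s powr (q - 1)" using s by (intro c_le) auto
        also have "\<dots> \<le> U r powr (q - 1)" using s U_nonneg U_mono q_gt_1 by (intro powr_mono2) auto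
        finally show ?thesis using c_nonneg[of "H k" s] by simp
      qed
    qed (use c_int[OF Hc] c_lim in auto)
    then have "(\<lambda>k. min (\<phi> (H k) r) (M r)) \<longlonglongrightarrow> min (\<phi> h r) (M r)"
      unfolding \<phi>_def by (intro tendsto_min tendsto_add tendsto_const)
    then have "(\<lambda>k. f (min (\<phi> (H k) r) (M r))) \<longlonglongrightarrow> f (min (\<phi> h r) (M r))"
    proof (rule continuous_on_tendsto_compose[OF f_cont])
      show "min (\<phi> h r) (M r) \<in> {0..}" using min_ge[OF hc r] by simp
      show "\<forall>\<^sub>F k in sequentially. min (\<phi> (H k) r) (M r) \<in> {0..}"
      proof (rule always_eventually, rule allI)
        fix k show "min (\<phi> (H k) r) (M r) \<in> {0..}" using min_ge[OF Hc r, of k] by simp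
      qed
    qed
    moreover have "(\<lambda>k. g (c (H k) r)) \<longlonglongrightarrow> g (c h r)"
      by (rule continuous_on_tendsto_compose[OF g_cont c_lim[OF r]]) (auto simp: c_nonneg)
    ultimately show "(\<lambda>k. W (H k) r) \<longlonglongrightarrow> W h r" unfolding W_def by (rule tendsto_diff)
  qed

  obtain h where hc: "continuous_on {0..} h" and hA: "\<And>r. 0 \<le> r \<Longrightarrow> h r = A h r"
    using solution_exists by blast
  have h0: "h 0 = 0" by (rule trans[OF hA A_nonpos]) auto
  define Y where "Y r = integral {0..r} (\<lambda>s. s ^ N * W h s)" for r
  have hY: "h r = Y r / r ^ N" if "0 \<le> r" for r using hA[OF that] by (simp add: A_def Y_def)
  have Yc: "continuous_on {0..} Y" unfolding Y_def by (rule continuous_on_integral_atLeast[OF cont_integrand[OF hc]])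
  have dY: "(Y has_real_derivative r ^ N * W h r) (at r)" if "0 < r" for r
    unfolding Y_def by (rule has_real_derivative_integral_atLeast[OF cont_integrand[OF hc] that])
  have Y0: "Y 0 = 0" by (simp add: Y_def)
  \<comment> \<open>A minimum argument for \<open>Y\<close>, that is for r^N h: at a minimum with
    nonpositive value the clamp gives \<open>c h s = 0\<close>, hence \<open>W h s > 0\<close>, and
    \<open>Y\<close> would be smaller just to the left.\<close>
  have h_pos: "0 < h r" if r: "0 < r" for r
  proof (rule ccontr)
    assume "\<not> 0 < h r"
    then have Yr: "Y r \<le> 0" using hY[of r] r by (simp add: not_less pos_divide_le_eq)
    obtain s1 where s1: "s1 \<in> {0..r}" "\<And>t. t \<in> {0..r} \<Longrightarrow> Y s1 \<le> Y t"
      using continuous_attains_inf[OF compact_Icc, of 0 r Y] continuous_on_subset[OF Yc] r by force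
    \<comment> \<open>If the minimum is attained at 0, then \<open>Y r \<le> 0 = Y 0\<close> makes
      \<open>r\<close> a minimiser as well; a positive minimiser has points to its left.\<close>
    define s where "s = (if s1 = 0 then r else s1)"
    have s: "0 < s" "s \<le> r" "\<And>t. 0 \<le> t \<Longrightarrow> t \<le> r \<Longrightarrow> Y s \<le> Y t"
    proof -
      show "0 < s" "s \<le> r" using s1(1) r by (auto simp: s_def)
      show "Y s \<le> Y t" if "0 \<le> t" "t \<le> r" for t
        using s1(2)[of t] that Yr Y0 by (auto simp: s_def)
    qed
    have "Y s \<le> 0" using s(3)[of 0] Y0 r by simp
    then have "h s \<le> 0" using hY[of s] s by (simp add: pos_divide_le_eq)
    then have "c h s = 0" using q_gt_1 by (simp add: c_def)
    then have "0 < W h s" using fmin_pos[OF hc, of s] s by (simp add: W_def g0)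
    then have "0 < s ^ N * W h s" using s by simp
    from DERIV_pos_inc_left[OF dY[OF s(1)] this] obtain d where d: "0 < d"
      "\<And>x. 0 < x \<Longrightarrow> x < d \<Longrightarrow> Y (s - x) < Y s" by blast
    define x where "x = min d s / 2"
    have x: "0 < x" "x < d" "x < s" using d s by (auto simp: x_def)
    have "Y s \<le> Y (s - x)" by (rule s(3)) (use x s(2) in auto)
    then show False using d(2)[OF x(1,2)] by simp
  qed
  have h_nonneg: "0 \<le> h r" if "0 \<le> r" for r using h_pos[of r] h0 that by (cases "r = 0") auto
  have h_le: "h r \<le> U r" if r: "0 \<le> r" for r
  proof (cases "r = 0")
    case False
    then have r: "0 < r" using r by simp
    have "Y r \<le> integral {0..r} (\<lambda>s. r ^ N * f (M r))"
      unfolding Y_def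
    proof (rule integral_le[OF integrable_integrand[OF hc]])
      fix s assume s: "s \<in> {0..r}"
      have "W h s \<le> f (M s)"
        using fmin_le[OF hc, of s] g_nonneg[OF c_nonneg[of h s]] s by (simp add: W_def)
      also have "\<dots> \<le> f (M r)" using s by (intro fM_mono) auto
      finally have "s ^ N * W h s \<le> s ^ N * f (M r)" using s by (intro mult_left_mono) auto
      also have "\<dots> \<le> r ^ N * f (M r)"
        using s fM_pos[of r] r by (intro mult_right_mono power_mono) auto
      finally show "s ^ N * W h s \<le> r ^ N * f (M r)" .
    qed auto
    also have "\<dots> = r ^ N * U r" using r by (simp add: U_def)
    finally show ?thesis using r by (simp add: hY field_simps)
  qed (simp add: h0 U_def)
  have ch: "c h r = h r powr (q - 1)" if "0 \<le> r" for r
    using h_nonneg[OF that] h_le[OF that] by (simp add: c_def)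
  have dphi: "(\<phi> h has_real_derivative h r powr (q - 1)) (at r within {0..})" if "0 \<le> r" for r
    unfolding \<phi>_def using has_real_derivative_integral_within_atLeast[OF c_cont[OF hc] that] ch[OF that]
    by (auto intro!: derivative_eq_intros)
  have dh: "(h has_real_derivative (W h r - N * h r / r)) (at r)" if r: "0 < r" for r
  proof -
    have "(A h has_real_derivative (W h r - N * h r / r)) (at r)"
      using A_deriv[OF hc r] hA[of r] r by simp
    then show ?thesis
      by (rule has_field_derivative_transform_within_open[of _ _ _ "{0<..}"]) (use r hA in auto)
  qed
  define v where "v r = f (min (\<phi> h r) (M r))" for r
  have phi_mono: "\<phi> h r \<le> \<phi> h s" if "0 \<le> r" "r \<le> s" for r s
    unfolding \<phi>_def using that c_int[OF hc] c_nonneg by (auto intro!: integral_subset_le)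
  have flow: "radial_flow (\<phi> h) h v"
    unfolding radial_flow_def
  proof (intro conjI allI impI)
    show "continuous_on {0..} h" "h 0 = 0" by (fact hc, fact h0)
    show "\<phi> h 0 = 1" by (simp add: \<phi>_def)
    show "mono_on {0..} v"
    proof (rule mono_onI)
      fix r s :: real assume "r \<in> {0..}" "s \<in> {0..}" "r \<le> s"
      then show "v r \<le> v s" unfolding v_def
        using min_ge[OF hc, of r] phi_mono[of r s] M_mono[of r s] by (intro f_le min.mono) auto
    qed
    show "0 \<le> v 0" using fmin_pos[OF hc, of 0] by (simp add: v_def)
    show "v r \<le> f (\<phi> h r)" if "0 \<le> r" for r
      unfolding v_def using min_ge[OF hc that] by (intro f_le) auto
    show "\<exists>d\<le>v r - g (h r powr (q - 1)). (h has_real_derivative d) (at r)" if r: "0 < r" for r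
    proof (intro exI conjI)
      show "(h has_real_derivative (W h r - N * h r / r)) (at r)" by (rule dh[OF r])
      show "W h r - N * h r / r \<le> v r - g (h r powr (q - 1))"
        using r h_pos[OF r] ch[of r] by (simp add: W_def v_def)
    qed
  qed (use h_pos dphi in auto)
  have phi_le: "\<phi> h r \<le> M r" if r: "0 \<le> r" for r
  proof (rule ccontr)
    assume "\<not> \<phi> h r \<le> M r"
    then have gt: "M r < \<phi> h r" by simp
    have r0: "r \<noteq> 0" using gt M(2)[of 0] by (auto simp: \<phi>_def)
    \<comment> \<open>By \<open>apriori\<close>, \<Phi>(\<phi>) grows at most at unit rate, whereas
      \<open>\<Phi> (M r) = r\<close>.\<close>
    have "\<Phi> (\<phi> h r) - r \<le> \<Phi> (\<phi> h 0) - 0"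
    proof (rule DERIV_nonpos_imp_decreasing_open[of 0 r "\<lambda>r. \<Phi> (\<phi> h r) - r", OF r])
      fix x assume x: "0 < x" "x < r"
      have "((\<lambda>r. \<Phi> (\<phi> h r)) has_real_derivative (1 / K (\<phi> h x) * h x powr (q - 1))) (at x)"
        by (rule DERIV_chain2[OF Phi_d[OF phi_gt_1[OF flow x(1)]] dphi_at[OF flow x(1)]])
      from DERIV_diff[OF this DERIV_ident]
      have "((\<lambda>r. \<Phi> (\<phi> h r) - r) has_real_derivative (1 / K (\<phi> h x) * h x powr (q - 1) - 1)) (at x)" .
      moreover have "1 / K (\<phi> h x) * h x powr (q - 1) - 1 \<le> 0"
        using apriori[OF flow, of x] Kpos[OF phi_ge[OF hc, of x]] x by (simp add: field_simps)
      ultimately show "\<exists>y. ((\<lambda>r. \<Phi> (\<phi> h r) - r) has_real_derivative y) (at x) \<and> y \<le> 0" by blast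
    next
      have "continuous_on {0..r} (\<lambda>r. \<Phi> (\<phi> h r))"
        by (rule continuous_on_compose2[OF Phi_c continuous_on_subset[OF phi_c[OF hc]]])
          (use phi_ge[OF hc] in auto)
      then show "continuous_on {0..r} (\<lambda>r. \<Phi> (\<phi> h r) - r)" by (intro continuous_on_diff continuous_on_id)
    qed
    then have "\<Phi> (\<phi> h r) \<le> r" by (simp add: \<phi>_def Phi1)
    then show False using Phi_less[OF M(2)[OF r] gt] M(1)[OF r] by simp
  qed
  have WW: "W h r = f (\<phi> h r) - g (h r powr (q - 1))" if "0 \<le> r" for r
    using phi_le[OF that] ch[OF that] by (simp add: W_def)
  define u where "u = (\<lambda>x::'a. \<phi> h (norm x))"
  note R = radial_plap_regular[OF hc h0 h_pos dphi dh[unfolded N_def] W_cont[OF hc], folded u_def]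
  have "plap_solution p f g u"
    unfolding plap_solution_def
  proof (intro conjI allI)
    show "plap_regular p u" by (rule R(1))
    show "p_laplacian p u x = f (u x) - g (norm (grad u x))" for x
      using R(2)[of x] R(3)[of x] WW[OF norm_ge_zero[of x]] by (simp add: u_def)
  qed
  moreover have "0 < u x" for x using phi_ge[OF hc, of "norm x"] by (simp add: u_def)
  ultimately show ?thesis by blast
qed

section \<open>The two growth conditions\<close>

lemma positive_solution_of_energy_condition:
  assumes inf: "(\<integral>\<^sup>+ s\<in>{1..}. ennreal (1 / F s powr (1 / p)) \<partial>lborel) = \<infinity>"
  shows "\<exists>u :: 'a::euclidean_space \<Rightarrow> real. plap_solution p f g u \<and> (\<forall>x. 0 < u x)"
proof (rule radial_solution_exists[of "\<lambda>s. (q * F s) powr (1 / p)"])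
  have Fp: "continuous_on {1..} (\<lambda>s. F s powr (1 / p))"
    by (rule continuous_on_powr'[OF continuous_on_subset[OF F_cont] continuous_on_const])
      (use F_nonneg p in auto)
  show "continuous_on {1..} (\<lambda>s. (q * F s) powr (1 / p))"
    using F_nonneg q_gt_1 continuous_on_mult_left[OF Fp, of "q powr (1 / p)"]
    by (simp add: powr_mult cong: continuous_on_cong)
  have Fpos: "0 < F s" if "1 \<le> s" for s using F_pos that by simp
  show "0 < (q * F s) powr (1 / p)" if "1 \<le> s" for s using Fpos[OF that] q_gt_1 by simp
  have c: "continuous_on {1..} (\<lambda>s. 1 / F s powr (1 / p))"
    by (rule continuous_on_divide[OF continuous_on_const Fp]) (use Fpos in force)
  \<comment> \<open>The constant \<open>q powr (1 / p)\<close> from the energy bound only rescales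
    the integral, so divergence persists.\<close>
  show "\<exists>s\<ge>1. B \<le> integral {1..s} (\<lambda>s. 1 / (q * F s) powr (1 / p))" for B
  proof -
    obtain s where s: "1 \<le> s" "B * q powr (1 / p) \<le> integral {1..s} (\<lambda>s. 1 / F s powr (1 / p))"
      using nn_integral_atLeast_infinite_imp_unbounded[OF c _ inf] by auto
    have "integral {1..s} (\<lambda>s. 1 / (q * F s) powr (1 / p))
        = integral {1..s} (\<lambda>s. 1 / q powr (1 / p) * (1 / F s powr (1 / p)))"
      by (intro integral_cong) (use Fpos q_gt_1 in \<open>auto simp: powr_mult less_imp_le\<close>)
    also have "\<dots> = 1 / q powr (1 / p) * integral {1..s} (\<lambda>s. 1 / F s powr (1 / p))"
      by (rule integral_mult_right)
    finally have I: "integral {1..s} (\<lambda>s. 1 / (q * F s) powr (1 / p))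
        = 1 / q powr (1 / p) * integral {1..s} (\<lambda>s. 1 / F s powr (1 / p))" .
    have "B \<le> integral {1..s} (\<lambda>s. 1 / (q * F s) powr (1 / p))"
      unfolding I using s(2) q_gt_1 by (simp add: pos_le_divide_eq)
    then show ?thesis using s by blast
  qed
  show "h r powr (q - 1) \<le> (q * F (\<phi> r)) powr (1 / p)" if "radial_flow \<phi> h v" "0 \<le> r" for \<phi> h v r
    by (rule energy_bound[OF that])
qed

text \<open>The comparison function \<open>K\<close> is the inverse of \<open>g\<close> composed
  with \<open>f\<close>; divergence of the integral also ensures that it is defined at all
  levels.\<close>

lemma positive_solution_of_gradient_condition:
  assumes inf: "(\<integral>\<^sup>+ s\<in>{1..}. ennreal (recip_ginv_f f g s) \<partial>lborel) = \<infinity>"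
  shows "\<exists>u :: 'a::euclidean_space \<Rightarrow> real. plap_solution p f g u \<and> (\<forall>x. 0 < u x)"
proof -
  have range_down: "\<exists>t\<ge>0. g t = y" if "0 \<le> y" "y \<le> g b" "0 \<le> b" for y b
    using IVT'[of g 0 y b] that g0 continuous_on_subset[OF g_cont, of "{0..b}"] by auto
  have inv: "g (inv0 g y) = y" "0 \<le> inv0 g y" if "\<exists>t\<ge>0. g t = y" for y
    using that inv0_strict_mono[OF g_mono] by auto
  \<comment> \<open>If \<open>f s\<close> were outside the range of \<open>g\<close>, so would be
    all later values, and the convention in \<open>recip_ginv_f\<close> would make the integrand
    vanish from \<open>s\<close> on; being bounded before \<open>s\<close>, it would have a finite
    integral.\<close>
  have in_range: "\<exists>t\<ge>0. g t = f s" if s: "0 \<le> s" for s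
  proof (rule ccontr)
    assume out: "\<not> (\<exists>t\<ge>0. g t = f s)"
    have out': "\<not> (\<exists>t\<ge>0. g t = f s')" if "s \<le> s'" for s'
      using out range_down[of "f s"] f_nonneg[OF s] f_le[OF s that] by metis
    \<comment> \<open>Where the inverse is defined, \<open>1 / inv0 g (f x)\<close> is nonincreasing
      in \<open>x\<close>, so its value at 1 is the bound. If \<open>f 1\<close> has no preimage,
      neither has any \<open>f x\<close> with \<open>x \<ge> 1\<close>, and the integrand is zero
      whatever \<open>C\<close> is.\<close>
    define C where "C = \<bar>1 / inv0 g (f 1)\<bar>"
    have le: "ennreal (recip_ginv_f f g x) * indicator {1..} x \<le> ennreal C * indicator {1..s} x" for x :: real
    proof (cases "1 \<le> x \<and> (\<exists>t\<ge>0. g t = f x)")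
      case True
      then have x: "1 \<le> x" "x \<le> s" using out'[of x] linear[of x s] by blast+
      have f1: "0 < f 1" "f 1 \<le> f x" using f_pos[of 1] f_le[of 1 x] x by auto
      have r1: "\<exists>t\<ge>0. g t = f 1" using True range_down[of "f 1"] f1 by (metis less_imp_le)
      have rx: "\<exists>t\<ge>0. g t = f x" using True by simp
      have "inv0 g (f 1) \<noteq> 0" using inv[OF r1] f1 g0 by auto
      then have i1: "0 < inv0 g (f 1)" using inv[OF r1] by simp
      have "inv0 g (f 1) \<le> inv0 g (f x)"
      proof (rule ccontr)
        assume "\<not> ?thesis"
        then have "g (inv0 g (f x)) < g (inv0 g (f 1))" using inv(2)[OF rx] by (intro g_less) auto
        then show False using inv(1)[OF r1] inv(1)[OF rx] f1 by auto
      qed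
      then have "1 / inv0 g (f x) \<le> C" unfolding C_def using i1 by (simp add: frac_le)
      then show ?thesis using rx x by (auto simp: recip_ginv_f_def intro: ennreal_leI)
    qed (auto simp: recip_ginv_f_def indicator_def)
    have "(\<integral>\<^sup>+ s\<in>{1..}. ennreal (recip_ginv_f f g s) \<partial>lborel) \<le> (\<integral>\<^sup>+ x. ennreal C * indicator {1..s} x \<partial>lborel)"
      by (intro nn_integral_mono le)
    also have "\<dots> = ennreal C * emeasure lborel {1..s}" by (rule nn_integral_cmult_indicator) auto
    also have "\<dots> < \<infinity>" by (simp add: ennreal_mult_less_top emeasure_lborel_Icc_eq)
    finally show False using inf by simp
  qed
  let ?K = "\<lambda>s. inv0 g (f s)"
  have Kpos: "0 < ?K s" if "1 \<le> s" for s
  proof -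
    have s: "0 \<le> s" using that by simp
    have "?K s \<noteq> 0" using inv(1)[OF in_range[OF s]] f_pos[of s] g0 that by auto
    then show ?thesis using inv(2)[OF in_range[OF s]] by simp
  qed
  have Kc: "continuous_on {1..} ?K"
  proof (rule continuous_on_compose2[OF continuous_on_inv0[OF g_mono] continuous_on_subset[OF f_cont]])
    show "f ` {1..} \<subseteq> g ` {0..}"
    proof
      fix y assume "y \<in> f ` {1..}"
      then obtain s where "1 \<le> s" "y = f s" by auto
      then show "y \<in> g ` {0..}" using in_range[of s] by force
    qed
  qed auto
  show ?thesis
  proof (rule radial_solution_exists[OF Kc Kpos])
    have c: "continuous_on {1..} (\<lambda>s. 1 / ?K s)"
      by (rule continuous_on_divide[OF continuous_on_const Kc]) (use Kpos in force)
    have "(\<integral>\<^sup>+ s\<in>{1..}. ennreal (1 / ?K s) \<partial>lborel) = (\<integral>\<^sup>+ s\<in>{1..}. ennreal (recip_ginv_f f g s) \<partial>lborel)"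
    proof (rule nn_integral_cong)
      fix s :: real
      show "ennreal (1 / ?K s) * indicator {1..} s = ennreal (recip_ginv_f f g s) * indicator {1..} s"
        using in_range[of s] by (cases "1 \<le> s") (auto simp: recip_ginv_f_def)
    qed
    then have infK: "(\<integral>\<^sup>+ s\<in>{1..}. ennreal (1 / ?K s) \<partial>lborel) = \<infinity>" using inf by simp
    show "\<exists>s\<ge>1. B \<le> integral {1..s} (\<lambda>s. 1 / ?K s)" for B
      by (rule nn_integral_atLeast_infinite_imp_unbounded[OF c _ infK]) (use Kpos in \<open>auto simp: less_imp_le\<close>)
    show "h r powr (q - 1) \<le> ?K (\<phi> r)" if fl: "radial_flow \<phi> h v" and r: "0 \<le> r" for \<phi> h v r
    proof (rule ccontr)
      assume gt: "\<not> ?thesis"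
      have ph: "0 \<le> \<phi> r" using phi_ge_1[OF fl r] by simp
      note i = inv[OF in_range[OF ph]]
      have "g (?K (\<phi> r)) < g (h r powr (q - 1))"
        by (rule g_less) (use i gt in auto)
      then show False using gradient_bound[OF fl r] i by simp
    qed
  qed
qed

end

theorem theorem1p2:
  fixes p :: real and f g :: "real \<Rightarrow> real"
  assumes p: "1 < p"
    and f_cont: "continuous_on {0..} f" and f_mono: "strict_mono_on {0..} f" and f0: "f 0 = 0"
    and g_lip: "\<forall>T\<ge>0. \<exists>L. L-lipschitz_on {0..T} g"
    and g_mono: "strict_mono_on {0..} g" and g0: "g 0 = 0"
  shows
    "((\<integral>\<^sup>+ s\<in>{1..}. ennreal (1 / inv0 (Gam p DIM('a) g) (primF f s)) \<partial>lborel) < \<infinity>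
        \<longrightarrow> (\<forall>u :: 'a::euclidean_space \<Rightarrow> real.
               plap_subsolution p f g u \<and> (\<forall>x. 0 \<le> u x) \<longrightarrow> (\<forall>x. u x = 0)))
     \<and> (((\<integral>\<^sup>+ s\<in>{1..}. ennreal (1 / primF f s powr (1 / p)) \<partial>lborel) = \<infinity>
          \<or> (\<integral>\<^sup>+ s\<in>{1..}. ennreal (recip_ginv_f f g s) \<partial>lborel) = \<infinity>)
        \<longrightarrow> (\<exists>u :: 'a \<Rightarrow> real. plap_solution p f g u \<and> (\<forall>x. 0 < u x)))"
proof -
  have g_cont: "continuous_on {0..} g"
    unfolding continuous_on_eq_continuous_within
  proof
    fix s :: real assume s: "s \<in> {0..}"
    then obtain L where "L-lipschitz_on {0..s + 1} g" using g_lip by (metis atLeast_iff add_increasing2 zero_le_one)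
    then have "continuous_on {0..s + 1} g" by (rule lipschitz_on_continuous_on)
    then have "continuous (at s within {0..s + 1}) g"
      using s by (auto simp: continuous_on_eq_continuous_within)
    moreover have "at s within {0..s + 1} = at s within {0..}"
      by (rule at_within_nhd[of _ "{..<s + 1}"]) (use s in auto)
    ultimately show "continuous (at s within {0..}) g" by simp
  qed
  interpret increasing_nonlinearities p "p / (p - 1)" f g
    using p f_cont f_mono f0 g_cont g_mono g0 by unfold_locales auto
  show ?thesis
    using keller_osserman_liouville positive_solution_of_energy_condition
      positive_solution_of_gradient_condition by blast
qed

end
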